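(* Let $c = \frac{1}{99}$. For every $\epsilon > 0$ there exists $n_0(\epsilon)$ such that for all $n \geq n_0(\epsilon)$: if $G$ is a graph on $n$ vertices that is $\epsilon$-far from every disjoint union of cliques, then $$\mathsf{sp}^*(G) \geq \frac{1}{2} n^{1+c}.$$
   Context: Graphs are finite, simple and undirected with adjacency matrix $A_G$. Define $$\mathsf{sp}^*(G) = \sup\left\{ \tfrac{1}{2}\langle -A_G, M\rangle : M \text{ real symmetric positive semidefinite with } M_{ii} \leq 1 \text{ for all } i\right\},$$ where $\langle X, Y\rangle = \sum_{i,j} X_{ij}Y_{ij}$. Two graphs $G$ and $H$ on $n$ vertices are $\epsilon$-close if starting from $G$ one can obtain a graph isomorphic to $H$ by adding or removing at most $\epsilon n^2$ edges; otherwise they are $\epsilon$-far. A disjoint union of cliques is a graph each of whose connected components is complete. *)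

theory Defs
  imports "HOL-Analysis.Analysis"
begin

record 'a sgraph =
  verts :: "'a set"
  edges :: "'a set set"

definition all_pairs :: "'a set \<Rightarrow> 'a set set" where
  "all_pairs V = {e. e \<subseteq> V \<and> card e = 2}"

definition simple_graph :: "'a sgraph \<Rightarrow> bool" where
  "simple_graph G \<longleftrightarrow> finite (verts G) \<and> edges G \<subseteq> all_pairs (verts G)"

definition adjacent :: "'a sgraph \<Rightarrow> 'a \<Rightarrow> 'a \<Rightarrow> bool" where
  "adjacent G u v \<longleftrightarrow> {u, v} \<in> edges G"

text \<open>Square real matrices indexed by a finite set \<open>V\<close> are functions \<open>'a \<Rightarrow> 'a \<Rightarrow> real\<close>
  of which only the entries in \<open>V \<times> V\<close> matter.\<close>

definition adj_mat :: "'a sgraph \<Rightarrow> 'a \<Rightarrow> 'a \<Rightarrow> real" where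
  "adj_mat G i j = (if adjacent G i j then 1 else 0)"

definition mat_inner :: "'a set \<Rightarrow> ('a \<Rightarrow> 'a \<Rightarrow> real) \<Rightarrow> ('a \<Rightarrow> 'a \<Rightarrow> real) \<Rightarrow> real" where
  "mat_inner V X Y = (\<Sum>i\<in>V. \<Sum>j\<in>V. X i j * Y i j)"

definition symmetric_on :: "'a set \<Rightarrow> ('a \<Rightarrow> 'a \<Rightarrow> real) \<Rightarrow> bool" where
  "symmetric_on V M \<longleftrightarrow> (\<forall>i\<in>V. \<forall>j\<in>V. M i j = M j i)"

definition psd_on :: "'a set \<Rightarrow> ('a \<Rightarrow> 'a \<Rightarrow> real) \<Rightarrow> bool" where
  "psd_on V M \<longleftrightarrow> symmetric_on V M \<and>
     (\<forall>x :: 'a \<Rightarrow> real. 0 \<le> (\<Sum>i\<in>V. \<Sum>j\<in>V. x i * M i j * x j))"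

text \<open>On a finite vertex set the supremum below is a genuine one: \<open>M = 0\<close> is feasible, and a
  feasible \<open>M\<close> has all entries in \<open>[-1, 1]\<close>, so the values are bounded.\<close>

definition sp_star :: "'a sgraph \<Rightarrow> real" where
  "sp_star G = Sup {1 / 2 * mat_inner (verts G) (\<lambda>i j. - adj_mat G i j) M | M.
     psd_on (verts G) M \<and> (\<forall>i\<in>verts G. M i i \<le> 1)}"

definition graph_iso :: "'a sgraph \<Rightarrow> 'b sgraph \<Rightarrow> bool" where
  "graph_iso G H \<longleftrightarrow> (\<exists>f. bij_betw f (verts G) (verts H) \<and>
     (\<forall>u\<in>verts G. \<forall>v\<in>verts G. adjacent G u v \<longleftrightarrow> adjacent H (f u) (f v)))"

text \<open>\<open>R\<close> is the set of removed and \<open>A\<close> the set of added edges.\<close>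

definition eps_close :: "real \<Rightarrow> 'a sgraph \<Rightarrow> 'b sgraph \<Rightarrow> bool" where
  "eps_close \<epsilon> G H \<longleftrightarrow> (\<exists>R A. R \<subseteq> edges G \<and> A \<subseteq> all_pairs (verts G) - edges G \<and>
     real (card R + card A) \<le> \<epsilon> * (real (card (verts G)))\<^sup>2 \<and>
     graph_iso (G\<lparr>edges := (edges G - R) \<union> A\<rparr>) H)"

definition eps_far :: "real \<Rightarrow> 'a sgraph \<Rightarrow> 'b sgraph \<Rightarrow> bool" where
  "eps_far \<epsilon> G H \<longleftrightarrow> \<not> eps_close \<epsilon> G H"

definition reachable :: "'a sgraph \<Rightarrow> 'a \<Rightarrow> 'a \<Rightarrow> bool" where
  "reachable G = (adjacent G)\<^sup>*\<^sup>*"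

definition components_of_graph :: "'a sgraph \<Rightarrow> 'a set set" where
  "components_of_graph G = (\<lambda>v. {w \<in> verts G. reachable G v w}) ` verts G"

definition clique_in :: "'a sgraph \<Rightarrow> 'a set \<Rightarrow> bool" where
  "clique_in G C \<longleftrightarrow> (\<forall>u\<in>C. \<forall>v\<in>C. u \<noteq> v \<longrightarrow> adjacent G u v)"

definition disjoint_union_of_cliques :: "'a sgraph \<Rightarrow> bool" where
  "disjoint_union_of_cliques G \<longleftrightarrow> simple_graph G \<and> (\<forall>C\<in>components_of_graph G. clique_in G C)"

end

theory Submission
  imports Defs
begin

text \<open>
Suppose the value is smaller than claimed. By semidefinite duality there are weights \<open>d \<ge> 0\<close> of
  total at most \<open>n\<^bsup>1+c\<^esup>\<close> with \<open>A + diag d\<close> positive semidefinite, so on all but \<open>\<delta>n\<close> vertices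
  \<open>B = A + lI\<close> is positive semidefinite, where \<open>l = n\<^sup>c/\<delta>\<close>. Let \<open>s(f)\<close> be the sum of the \<open>f\<close> largest
  eigenvalues of \<open>B\<close>, divided by the number \<open>N\<close> of vertices, and \<open>L\<close> the part of \<open>B\<close> on the
  corresponding eigenvectors. The Hadamard square of \<open>L\<close> has rank at most \<open>f\<^sup>2\<close> and lies below that of
  \<open>B\<close>, which is \<open>A + l\<^sup>2I\<close> because \<open>A\<close> is a 0/1 matrix; hence \<open>s(f)\<^sup>2 \<le> s(f\<^sup>2) + l\<^sup>2f\<^sup>2/N\<close>. Starting from
  the trivial bound \<open>s \<le> l\<close>, this gives \<open>s(f) \<le> 2f\<^bsup>1/4\<^esup>\<close> for all \<open>f \<ge> 2\<close>, so \<open>A\<close> is approximated in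
  Frobenius norm by a matrix of bounded rank. If \<open>A\<close> is dense, the pigeonhole principle applied to
  the spectral coordinates yields a linear-size vertex set of density close to 1, in which the
  entrywise cube of \<open>B\<close> minus its all-ones component forces all but \<open>O(l\<^sup>3)\<close> non-edges per vertex to
  disappear; this produces a clique of size at least \<open>40l\<^sup>3\<close>. Every other vertex sees almost all or
  almost none of such a clique, and the vertices of the first kind form an almost complete and
  almost isolated set. Splitting off such sets until few edges are left exhibits a nearby disjoint
  union of cliques.
\<close>

section \<open>Bilinear forms and orthogonal systems\<close>

definition bil :: "'a set \<Rightarrow> ('a \<Rightarrow> 'a \<Rightarrow> real) \<Rightarrow> ('a \<Rightarrow> real) \<Rightarrow> ('a \<Rightarrow> real) \<Rightarrow> real" where
  "bil W M x y = (\<Sum>i\<in>W. \<Sum>j\<in>W. x i * M i j * y j)"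

definition ip :: "'a set \<Rightarrow> ('a \<Rightarrow> real) \<Rightarrow> ('a \<Rightarrow> real) \<Rightarrow> real" where
  "ip W x y = (\<Sum>i\<in>W. x i * y i)"

lemma psd_on_iff_bil: "psd_on W M \<longleftrightarrow> symmetric_on W M \<and> (\<forall>x. 0 \<le> bil W M x x)"
  by (simp add: psd_on_def bil_def)

lemma bil_nonneg: "psd_on W M \<Longrightarrow> 0 \<le> bil W M x x"
  by (simp add: psd_on_iff_bil)

lemma bil_commute:
  assumes "symmetric_on W M"
  shows "bil W M x y = bil W M y x"
proof -
  have "bil W M x y = (\<Sum>j\<in>W. \<Sum>i\<in>W. x i * M i j * y j)"
    unfolding bil_def by (rule sum.swap)
  also have "\<dots> = bil W M y x"
    unfolding bil_def using assms
    by (intro sum.cong refl) (simp add: symmetric_on_def mult.commute mult.left_commute)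
  finally show ?thesis .
qed

lemma bil_add_left: "bil W M (\<lambda>i. x i + y i) z = bil W M x z + bil W M y z"
  by (simp add: bil_def sum.distrib algebra_simps)

lemma bil_scale_left: "bil W M (\<lambda>i. a * x i) z = a * bil W M x z"
  by (simp add: bil_def sum_distrib_left algebra_simps)

lemma bil_add_right: "bil W M z (\<lambda>i. x i + y i) = bil W M z x + bil W M z y"
  by (simp add: bil_def sum.distrib algebra_simps)

lemma bil_scale_right: "bil W M z (\<lambda>i. a * x i) = a * bil W M z x"
  by (simp add: bil_def sum_distrib_left algebra_simps)

lemma bil_lincomb:
  assumes "symmetric_on W M"
  shows "bil W M (\<lambda>i. x i + t * y i) (\<lambda>i. x i + t * y i)
    = bil W M x x + 2 * t * bil W M x y + t\<^sup>2 * bil W M y y"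
  by (simp add: bil_add_left bil_add_right bil_scale_left bil_scale_right
      bil_commute[OF assms, of y x] algebra_simps power2_eq_square)

lemma bil_add_mat: "bil W (\<lambda>i j. M i j + M' i j) x y = bil W M x y + bil W M' x y"
  by (simp add: bil_def sum.distrib algebra_simps)

lemma bil_diff_mat: "bil W (\<lambda>i j. M i j - M' i j) x y = bil W M x y - bil W M' x y"
  by (simp add: bil_def sum_subtractf algebra_simps)

lemma bil_rank_one: "bil W (\<lambda>i j. c * (u i * u j)) x y = c * (ip W u x * ip W u y)"
proof -
  have "ip W u x * ip W u y = (\<Sum>i\<in>W. \<Sum>j\<in>W. (u i * x i) * (u j * y j))"
    unfolding ip_def by (rule sum_product)
  then show ?thesis
    by (simp add: bil_def sum_distrib_left mult_ac)
qed

lemma bil_sum_mat: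
  "bil W (\<lambda>i j. \<Sum>k\<in>K. M k i j) x y = (\<Sum>k\<in>K. bil W (M k) x y)"
proof -
  have "bil W (\<lambda>i j. \<Sum>k\<in>K. M k i j) x y = (\<Sum>i\<in>W. \<Sum>j\<in>W. \<Sum>k\<in>K. x i * M k i j * y j)"
    by (simp add: bil_def sum_distrib_left sum_distrib_right)
  also have "\<dots> = (\<Sum>i\<in>W. \<Sum>k\<in>K. \<Sum>j\<in>W. x i * M k i j * y j)"
    by (intro sum.cong refl sum.swap)
  also have "\<dots> = (\<Sum>k\<in>K. bil W (M k) x y)"
    unfolding bil_def by (rule sum.swap)
  finally show ?thesis .
qed

lemma bil_cong:
  assumes "\<And>i j. i \<in> W \<Longrightarrow> j \<in> W \<Longrightarrow> M i j = M' i j"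
  shows "bil W M x y = bil W M' x y"
  unfolding bil_def using assms by (intro sum.cong refl) simp

lemma ip_commute: "ip W x y = ip W y x"
  by (simp add: ip_def mult.commute)

lemma ip_diff_right: "ip W z (\<lambda>i. x i - y i) = ip W z x - ip W z y"
  by (simp add: ip_def sum_subtractf algebra_simps)

lemma ip_scale_left: "ip W (\<lambda>i. a * x i) z = a * ip W x z"
  by (simp add: ip_def sum_distrib_left algebra_simps)

lemma ip_scale_right: "ip W z (\<lambda>i. a * x i) = a * ip W z x"
  by (simp add: ip_def sum_distrib_left algebra_simps)

lemma ip_sum_right: "ip W z (\<lambda>i. \<Sum>k\<in>K. c k * x k i) = (\<Sum>k\<in>K. c k * ip W z (x k))"
proof -
  have "ip W z (\<lambda>i. \<Sum>k\<in>K. c k * x k i) = (\<Sum>i\<in>W. \<Sum>k\<in>K. z i * (c k * x k i))"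
    by (simp add: ip_def sum_distrib_left)
  also have "\<dots> = (\<Sum>k\<in>K. \<Sum>i\<in>W. z i * (c k * x k i))" by (rule sum.swap)
  also have "\<dots> = (\<Sum>k\<in>K. c k * ip W z (x k))"
    by (simp add: ip_def sum_distrib_left mult_ac)
  finally show ?thesis .
qed

lemma ip_nonneg: "0 \<le> ip W x x"
  by (simp add: ip_def sum_nonneg)

lemma ip_eq_0D: "finite W \<Longrightarrow> ip W x x = 0 \<Longrightarrow> i \<in> W \<Longrightarrow> x i = 0"
  unfolding ip_def by (subst (asm) sum_nonneg_eq_0_iff) auto

lemma ip_zero_of_null: "finite W \<Longrightarrow> ip W x x = 0 \<Longrightarrow> ip W y x = 0"
  using ip_eq_0D[of W x] unfolding ip_def[of W y x] by simp

lemma ip_lincomb: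
  "ip W (\<lambda>i. x i + t * y i) (\<lambda>i. x i + t * y i) = ip W x x + 2 * t * ip W x y + t\<^sup>2 * ip W y y"
  by (simp add: ip_def sum.distrib sum_distrib_left algebra_simps power2_eq_square)

text \<open>At the vertex \<open>t = - b / c\<close> nonnegativity is the discriminant bound. The
  degenerate case \<open>c = 0\<close> and the impossible case \<open>c < 0\<close> are handled
  inside, so a caller owes only the nonnegativity of the polynomial.\<close>

lemma nonneg_quadratic_discriminant:
  fixes a b c :: real
  assumes "\<And>t. 0 \<le> a + 2 * t * b + t\<^sup>2 * c"
  shows "b\<^sup>2 \<le> a * c"
proof (cases "c = 0")
  case True
  have "b = 0"
  proof (rule ccontr)
    assume "b \<noteq> 0"
    have "0 \<le> a + 2 * (- (a + 1) / (2 * b)) * b" using assms[of "- (a + 1) / (2 * b)"] True by simp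
    also have "\<dots> = -1" using \<open>b \<noteq> 0\<close> by (simp add: field_simps)
    finally show False by simp
  qed
  then show ?thesis using True by simp
next
  case False
  have "0 \<le> c"
  proof (rule ccontr)
    assume "\<not> 0 \<le> c"
    then have c: "c < 0" by simp
    \<comment> \<open>Large enough for the quadratic term to outweigh the other two, and at least 1
      so that \<open>\<bar>a\<bar>\<close> may be multiplied by it.\<close>
    define t where "t = (\<bar>a\<bar> + 2 * \<bar>b\<bar> + 1) / (- c) + 1"
    have t1: "t \<ge> 1" using c by (simp add: t_def divide_nonneg_neg)
    have tc: "t * (- c) = \<bar>a\<bar> + 2 * \<bar>b\<bar> + 1 - c" using c by (simp add: t_def field_simps)
    have "a + 2 * t * b + t\<^sup>2 * c \<le> t * \<bar>a\<bar> + t * (2 * \<bar>b\<bar>) - t * (t * (- c))"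
    proof -
      have "a \<le> t * \<bar>a\<bar>" using t1 mult_right_mono[of 1 t "\<bar>a\<bar>"] by linarith
      moreover have "2 * t * b \<le> t * (2 * \<bar>b\<bar>)" using t1 by (simp add: mult_left_mono)
      ultimately show ?thesis by (simp add: power2_eq_square algebra_simps)
    qed
    also have "\<dots> = t * (c - 1)" unfolding tc by (simp add: algebra_simps)
    also have "\<dots> < 0" using t1 c by (simp add: mult_pos_neg)
    finally show False using assms[of t] by simp
  qed
  with False have c: "c > 0" by simp
  have "0 \<le> a + 2 * (- b / c) * b + (- b / c)\<^sup>2 * c" by (rule assms)
  also have "\<dots> = a - b\<^sup>2 / c" using c by (simp add: field_simps power2_eq_square)
  finally show ?thesis using c by (simp add: field_simps)
qed

lemma bil_Cauchy_Schwarz: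
  assumes "psd_on W M"
  shows "(bil W M x y)\<^sup>2 \<le> bil W M x x * bil W M y y"
proof (rule nonneg_quadratic_discriminant)
  fix t
  have "symmetric_on W M" using assms by (simp add: psd_on_iff_bil)
  from bil_lincomb[OF this, of x t y] bil_nonneg[OF assms, of "\<lambda>i. x i + t * y i"]
  show "0 \<le> bil W M x x + 2 * t * bil W M x y + t\<^sup>2 * bil W M y y" by simp
qed

text \<open>A vector on \<open>U\<close> extended by zero is a vector on \<open>W\<close> with the
  same value of the form.\<close>

lemma psd_on_subset:
  assumes "psd_on W M" "U \<subseteq> W" "finite W"
  shows "psd_on U M"
  unfolding psd_on_iff_bil
proof (intro conjI allI)
  show "symmetric_on U M" using assms by (auto simp: psd_on_def symmetric_on_def)
  fix x :: "'a \<Rightarrow> real"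
  define x' where "x' = (\<lambda>i. if i \<in> U then x i else 0)"
  have inner: "(\<Sum>j\<in>W. x' i * M i j * x' j) = (\<Sum>j\<in>U. x' i * M i j * x' j)" for i
    by (rule sum.mono_neutral_right) (use assms in \<open>auto simp: x'_def\<close>)
  have "bil W M x' x' = (\<Sum>i\<in>W. \<Sum>j\<in>U. x' i * M i j * x' j)" by (simp add: bil_def inner)
  also have "\<dots> = (\<Sum>i\<in>U. \<Sum>j\<in>U. x' i * M i j * x' j)"
    by (rule sum.mono_neutral_right) (use assms in \<open>auto simp: x'_def\<close>)
  also have "\<dots> = bil U M x x" by (simp add: bil_def x'_def)
  finally show "0 \<le> bil U M x x" using bil_nonneg[OF assms(1)] by metis
qed

text \<open>Zero vectors are allowed in an orthogonal system, so that degenerate vectors need not be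
  dropped and re-indexed.\<close>

definition orth_sys :: "'a set \<Rightarrow> nat \<Rightarrow> (nat \<Rightarrow> 'a \<Rightarrow> real) \<Rightarrow> bool" where
  "orth_sys W r y \<longleftrightarrow> (\<forall>i<r. \<forall>j<r. i \<noteq> j \<longrightarrow> ip W (y i) (y j) = 0) \<and>
     (\<forall>i<r. ip W (y i) (y i) = 0 \<or> ip W (y i) (y i) = 1)"

section \<open>Residuals, Bessel's inequality and Gram-Schmidt\<close>

definition residual :: "'a set \<Rightarrow> nat \<Rightarrow> (nat \<Rightarrow> 'a \<Rightarrow> real) \<Rightarrow> ('a \<Rightarrow> real) \<Rightarrow> 'a \<Rightarrow> real" where
  "residual W r y z = (\<lambda>i. z i - (\<Sum>k<r. ip W z (y k) * y k i))"

lemma residual_orth: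
  assumes "finite W" "orth_sys W r y" "j < r"
  shows "ip W (y j) (residual W r y z) = 0"
proof -
  have "(\<Sum>k<r. ip W z (y k) * ip W (y j) (y k)) = (\<Sum>k<r. if k = j then ip W z (y j) * ip W (y j) (y j) else 0)"
    using assms(2,3) by (intro sum.cong refl) (auto simp: orth_sys_def)
  also have "\<dots> = ip W z (y j) * ip W (y j) (y j)" using assms(3) by simp
  \<comment> \<open>If \<open>y j\<close> is a zero vector, then both sides vanish; otherwise the
    second factor is 1.\<close>
  also have "\<dots> = ip W z (y j)"
  proof (cases "ip W (y j) (y j) = 0")
    case True
    then show ?thesis using ip_zero_of_null[OF assms(1) True, of z] by simp
  next
    case False
    then show ?thesis using assms(2,3) by (auto simp: orth_sys_def)
  qed
  finally show ?thesis
    by (simp add: residual_def ip_diff_right ip_sum_right ip_commute)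
qed

lemma ip_residual:
  assumes "finite W" "orth_sys W r y"
  shows "ip W (residual W r y z) (residual W r y z) = ip W z z - (\<Sum>k<r. (ip W z (y k))\<^sup>2)"
    and "ip W z (residual W r y z) = ip W z z - (\<Sum>k<r. (ip W z (y k))\<^sup>2)"
proof -
  let ?r = "residual W r y z"
  show 2: "ip W z ?r = ip W z z - (\<Sum>k<r. (ip W z (y k))\<^sup>2)"
    by (simp add: residual_def ip_diff_right ip_sum_right power2_eq_square)
  have "ip W ?r ?r = ip W ?r z - (\<Sum>k<r. ip W z (y k) * ip W ?r (y k))"
    by (subst (2) residual_def) (simp add: ip_diff_right ip_sum_right)
  also have "(\<Sum>k<r. ip W z (y k) * ip W ?r (y k)) = 0"
    by (intro sum.neutral ballI) (simp add: ip_commute[of W ?r] residual_orth[OF assms])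
  finally show "ip W ?r ?r = ip W z z - (\<Sum>k<r. (ip W z (y k))\<^sup>2)"
    using 2 by (simp add: ip_commute[of W ?r z])
qed

lemma bessel:
  assumes "finite W" "orth_sys W r y"
  shows "(\<Sum>k<r. (ip W z (y k))\<^sup>2) \<le> ip W z z"
  using ip_residual(1)[OF assms, of z] ip_nonneg[of W "residual W r y z"] by linarith

lemma orth_sys_extend:
  assumes "orth_sys W r y" "\<And>k. k < r \<Longrightarrow> ip W (y k) v = 0" "ip W v v = 0 \<or> ip W v v = 1"
  shows "orth_sys W (Suc r) (y(r := v))"
proof -
  have "ip W v (y k) = 0" if "k < r" for k using assms(2)[OF that] by (simp add: ip_commute[of W v "y k"])
  then show ?thesis using assms by (auto simp: orth_sys_def less_Suc_eq)
qed

text \<open>Equality in Bessel's inequality expresses that each \<open>z i\<close> lies in the span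
  of \<open>y\<close>, in a form that can be summed directly. Dependent vectors produce zero
  vectors, so both sequences have the same length.\<close>

lemma gram_schmidt:
  assumes "finite W"
  shows "\<exists>y. orth_sys W r y \<and> (\<forall>i<r. (\<Sum>k<r. (ip W (z i) (y k))\<^sup>2) = ip W (z i) (z i))"
proof (induction r)
  case 0
  show ?case by (simp add: orth_sys_def)
next
  case (Suc r)
  then obtain y where y: "orth_sys W r y"
    and yz: "\<And>i. i < r \<Longrightarrow> (\<Sum>k<r. (ip W (z i) (y k))\<^sup>2) = ip W (z i) (z i)" by blast
  define \<rho> where "\<rho> = residual W r y (z r)"
  \<comment> \<open>For a null residual this is \<open>1 / 0 = 0\<close>, and \<open>v\<close>
    becomes the zero vector, which \<open>orth_sys\<close> admits.\<close>
  define q where "q = 1 / sqrt (ip W \<rho> \<rho>)"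
  define v where "v = (\<lambda>i. q * \<rho> i)"
  have ipv: "ip W u v = ip W u \<rho> / sqrt (ip W \<rho> \<rho>)" for u
    unfolding v_def ip_scale_right by (simp add: q_def)
  have vv: "ip W v v = (1 / sqrt (ip W \<rho> \<rho>)) * ((1 / sqrt (ip W \<rho> \<rho>)) * ip W \<rho> \<rho>)"
    unfolding v_def ip_scale_right ip_scale_left q_def ..
  have "ip W v v = 0 \<or> ip W v v = 1"
  proof (cases "ip W \<rho> \<rho> = 0")
    case False
    then have "ip W \<rho> \<rho> > 0" using ip_nonneg[of W \<rho>] by linarith
    then show ?thesis unfolding vv by simp
  qed (simp add: vv)
  moreover have "ip W (y k) v = 0" if "k < r" for k
    using residual_orth[OF assms y that, of "z r"] by (simp add: ipv \<rho>_def)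
  ultimately have sys: "orth_sys W (Suc r) (y(r := v))" by (intro orth_sys_extend y)
  have split: "(\<Sum>k<Suc r. (ip W u ((y(r := v)) k))\<^sup>2) = (\<Sum>k<r. (ip W u (y k))\<^sup>2) + (ip W u v)\<^sup>2" for u
    by simp
  have "(\<Sum>k<Suc r. (ip W (z i) ((y(r := v)) k))\<^sup>2) = ip W (z i) (z i)" if "i < Suc r" for i
  proof (cases "i < r")
    case True
    \<comment> \<open>The old coefficients already exhaust the squared length of \<open>z i\<close>,
      so Bessel for the longer system leaves nothing for the new one.\<close>
    have "(\<Sum>k<r. (ip W (z i) (y k))\<^sup>2) + (ip W (z i) v)\<^sup>2 \<le> ip W (z i) (z i)"
      using bessel[OF assms sys, of "z i"] unfolding split .
    then show ?thesis unfolding split using yz[OF True] zero_le_power2[of "ip W (z i) v"] by linarith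
  next
    case False
    then have i: "i = r" using that by simp
    have z\<rho>: "ip W (z r) \<rho> = ip W \<rho> \<rho>" using ip_residual[OF assms y, of "z r"] by (simp add: \<rho>_def)
    have "(ip W (z r) v)\<^sup>2 = ip W \<rho> \<rho>"
      using ip_nonneg[of W \<rho>]
      by (simp add: ipv z\<rho> power_divide) (simp add: power2_eq_square)
    then show ?thesis unfolding split i using ip_residual(1)[OF assms y, of "z r"] by (simp add: \<rho>_def)
  qed
  with sys show ?case by blast
qed

section \<open>Spectral decomposition and Schur products\<close>

text \<open>The form is continuous on the compact unit sphere and attains its maximum there; scaling
  carries the bound to all vectors.\<close>

lemma rayleigh_max:
  fixes W :: "'a set" and M :: "'a \<Rightarrow> 'a \<Rightarrow> real"
  assumes "finite W" "W \<noteq> {}"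
  shows "\<exists>v. ip W v v = 1 \<and> (\<forall>y. bil W M y y \<le> bil W M v v * ip W y y)"
proof -
  \<comment> \<open>Functions vanishing off \<open>W\<close> with values in [-1, 1] on it: a product
    of compact sets, compact even if the type \<open>'a\<close> is infinite.\<close>
  define B :: "('a \<Rightarrow> real) set" where "B = PiE UNIV (\<lambda>i. if i \<in> W then {-1..1} else {0})"
  define S where "S = B \<inter> {x. ip W x x = 1}"
  have coord: "continuous_on X (\<lambda>x::'a \<Rightarrow> real. x i)" for X i
    by (rule continuous_on_subset[OF continuous_on_product_coordinates]) simp
  have "compactin (product_topology (\<lambda>i. euclidean) UNIV) B"
    unfolding B_def compactin_PiE by auto
  then have "compact B" by (simp add: euclidean_product_topology)
  moreover have "closed {x. ip W x x = 1}"
    unfolding ip_def by (intro closed_Collect_eq continuous_intros coord)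
  ultimately have "compact S" unfolding S_def by (rule compact_Int_closed)
  obtain w where w: "w \<in> W" using assms by blast
  have "(\<lambda>i. if i = w then 1 else 0) \<in> S"
    using w assms(1) by (auto simp: S_def B_def ip_def if_distrib[where f="\<lambda>a. a * _"] cong: if_cong)
  then have "S \<noteq> {}" by blast
  have "continuous_on S (\<lambda>x. bil W M x x)"
    unfolding bil_def by (intro continuous_intros coord)
  from continuous_attains_sup[OF \<open>compact S\<close> \<open>S \<noteq> {}\<close> this] obtain v
    where v: "v \<in> S" and vmax: "\<And>y. y \<in> S \<Longrightarrow> bil W M y y \<le> bil W M v v" by blast
  have "bil W M y y \<le> bil W M v v * ip W y y" for y
  proof (cases "ip W y y = 0")
    case True
    have "y i = 0" if "i \<in> W" for i using ip_eq_0D[OF assms(1) True that] .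
    then have "bil W M y y = 0" by (simp add: bil_def)
    then show ?thesis using True by simp
  next
    case False
    then have pos: "ip W y y > 0" using ip_nonneg[of W y] by linarith
    define q where "q = 1 / sqrt (ip W y y)"
    have q2: "q * q * ip W y y = 1" using pos by (simp add: q_def)
    define y' where "y' = (\<lambda>i. if i \<in> W then q * y i else 0)"
    have ip': "ip W y' y' = 1"
      using q2 by (simp add: ip_def y'_def sum_distrib_left mult_ac)
    have "\<bar>y' i\<bar> \<le> 1" if "i \<in> W" for i
    proof -
      have "(y' i)\<^sup>2 \<le> ip W y' y'"
        unfolding ip_def power2_eq_square using that assms(1)
        by (intro member_le_sum) auto
      then show ?thesis using ip' by (simp add: abs_square_le_1)
    qed
    then have "y' \<in> B" by (auto simp: B_def PiE_iff y'_def abs_le_iff)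
    then have "bil W M y' y' \<le> bil W M v v" using ip' vmax by (simp add: S_def)
    moreover have "bil W M y' y' = q * q * bil W M y y"
      by (simp add: bil_def y'_def sum_distrib_left mult_ac)
    ultimately have "(q * q * bil W M y y) * ip W y y \<le> bil W M v v * ip W y y"
      using pos by (simp add: mult_right_mono)
    moreover have "(q * q * bil W M y y) * ip W y y = bil W M y y"
      using q2 by (simp add: mult_ac)
    ultimately show ?thesis by simp
  qed
  then show ?thesis using v by (auto simp: S_def)
qed

text \<open>The first variation vanishes at a maximum: the quadratic in \<open>t\<close> that
  measures the deficit at \<open>v + t y\<close> has constant term 0, so its linear coefficient is
  0. The conclusion is the eigenvector equation tested against every \<open>y\<close>.\<close>

lemma rayleigh_max_eigenvector:
  assumes "symmetric_on W M" "ip W v v = 1" "\<And>y. bil W M y y \<le> bil W M v v * ip W y y"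
  shows "bil W M y v = bil W M v v * ip W y v"
proof -
  let ?m = "bil W M v v"
  have "(?m * ip W v y - bil W M v y)\<^sup>2 \<le> 0 * (?m * ip W y y - bil W M y y)"
  proof (rule nonneg_quadratic_discriminant)
    fix t
    show "0 \<le> 0 + 2 * t * (?m * ip W v y - bil W M v y) + t\<^sup>2 * (?m * ip W y y - bil W M y y)"
      using assms(3)[of "\<lambda>i. v i + t * y i"]
      unfolding bil_lincomb[OF assms(1)] ip_lincomb assms(2) by (simp add: algebra_simps)
  qed
  then show ?thesis
    by (simp add: bil_commute[OF assms(1), of y v] ip_commute[of W y v])
qed

lemma bil_unit: "finite W \<Longrightarrow> u \<in> W \<Longrightarrow> w \<in> W \<Longrightarrow>
  bil W M (\<lambda>i. if i = u then 1 else 0) (\<lambda>i. if i = w then 1 else 0) = M u w"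
  by (simp add: bil_def if_distrib[where f="\<lambda>a. a * _"] if_distrib[where f="\<lambda>a. _ * a"] cong: if_cong)

lemma ip_unit: "finite W \<Longrightarrow> u \<in> W \<Longrightarrow> ip W (\<lambda>i. if i = u then 1 else 0) x = x u"
  by (simp add: ip_def if_distrib[where f="\<lambda>a. a * _"] cong: if_cong)

lemma psd_on_rank_one_sum:
  assumes "\<And>i. i \<in> I \<Longrightarrow> 0 \<le> (\<mu> i :: real)"
  shows "psd_on W (\<lambda>u w. \<Sum>i\<in>I. \<mu> i * (x i u * x i w))"
  unfolding psd_on_iff_bil bil_sum_mat bil_rank_one
  using assms by (auto simp: symmetric_on_def mult_ac intro!: sum_nonneg)

text \<open>Bessel's inequality for the coordinate unit vectors, summed over \<open>W\<close>. It
  bounds the number of nonzero vectors of the system by the dimension.\<close>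

lemma orth_sys_card:
  assumes "finite W" "orth_sys W r x"
  shows "(\<Sum>i<r. ip W (x i) (x i)) \<le> real (card W)"
proof -
  have "(\<Sum>i<r. ip W (x i) (x i)) = (\<Sum>u\<in>W. \<Sum>i<r. x i u * x i u)"
    unfolding ip_def by (rule sum.swap)
  also have "\<dots> \<le> (\<Sum>u\<in>W. 1)"
  proof (rule sum_mono)
    fix u assume u: "u \<in> W"
    have "(\<Sum>i<r. (ip W (\<lambda>j. if j = u then 1 else 0) (x i))\<^sup>2) \<le>
        ip W (\<lambda>j. if j = u then 1 else 0) (\<lambda>j. if j = u then 1 else 0)"
      by (rule bessel[OF assms])
    then show "(\<Sum>i<r. x i u * x i u) \<le> 1"
      using u by (simp add: ip_unit[OF assms(1) u] power2_eq_square)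
  qed
  finally show ?thesis by simp
qed

section \<open>Deflation and the spectral theorem\<close>

definition remainder :: "('a \<Rightarrow> 'a \<Rightarrow> real) \<Rightarrow> nat \<Rightarrow> (nat \<Rightarrow> real) \<Rightarrow> (nat \<Rightarrow> 'a \<Rightarrow> real) \<Rightarrow> 'a \<Rightarrow> 'a \<Rightarrow> real" where
  "remainder M k \<mu> x = (\<lambda>u w. M u w - (\<Sum>i<k. \<mu> i * (x i u * x i w)))"

text \<open>The invariant after \<open>k\<close> steps. The last clause bounds the remainder by
  every eigenvalue found so far; it makes the next eigenvalue no larger, and it makes the remainder
  vanish once some eigenvalue is 0.\<close>

definition deflated :: "'a set \<Rightarrow> ('a \<Rightarrow> 'a \<Rightarrow> real) \<Rightarrow> nat \<Rightarrow> (nat \<Rightarrow> real) \<Rightarrow> (nat \<Rightarrow> 'a \<Rightarrow> real) \<Rightarrow> bool" where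
  "deflated W M k \<mu> x \<longleftrightarrow> orth_sys W k x \<and> psd_on W (remainder M k \<mu> x) \<and>
    (\<forall>i<k. 0 \<le> \<mu> i \<and> (ip W (x i) (x i) = 0 \<longrightarrow> \<mu> i = 0) \<and> (\<forall>j<i. \<mu> i \<le> \<mu> j) \<and>
      (\<forall>y. bil W (remainder M k \<mu> x) y (x i) = 0) \<and>
      (\<forall>y. bil W (remainder M k \<mu> x) y y \<le> \<mu> i * ip W y y))"

text \<open>Each step subtracts the rank-one part of a top eigenvector \<open>v\<close> of the
  remainder. The remainder stays positive semidefinite by Cauchy-Schwarz for its own form, applied
  to \<open>y\<close> and \<open>v\<close>.\<close>

lemma deflation:
  fixes M :: "'a \<Rightarrow> 'a \<Rightarrow> real"
  assumes fin: "finite W" and ne: "W \<noteq> {}" and psd: "psd_on W M"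
  shows "\<exists>\<mu> x. deflated W M k \<mu> x"
proof (induction k)
  case 0
  show ?case using psd by (simp add: orth_sys_def deflated_def remainder_def)
next
  case (Suc k)
  then obtain \<mu> x where defl: "deflated W M k \<mu> x" by blast
  define R where "R = remainder M k \<mu> x"
  have ind: "orth_sys W k x" "\<And>i. i < k \<Longrightarrow> 0 \<le> \<mu> i"
      "\<And>i. i < k \<Longrightarrow> ip W (x i) (x i) = 0 \<Longrightarrow> \<mu> i = 0" "\<And>i j. i < k \<Longrightarrow> j < i \<Longrightarrow> \<mu> i \<le> \<mu> j"
    and R: "psd_on W R" "\<And>i y. i < k \<Longrightarrow> bil W R y (x i) = 0"
      "\<And>i y. i < k \<Longrightarrow> bil W R y y \<le> \<mu> i * ip W y y"
    using defl unfolding deflated_def R_def by auto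
  have symR: "symmetric_on W R" using R(1) by (simp add: psd_on_iff_bil)
  obtain v where v: "ip W v v = 1" "\<And>y. bil W R y y \<le> bil W R v v * ip W y y"
    using rayleigh_max[OF fin ne, of R] by blast
  define m where "m = bil W R v v"
  have m0: "0 \<le> m" using bil_nonneg[OF R(1)] by (simp add: m_def)
  have eig: "bil W R y v = m * ip W y v" for y
    unfolding m_def by (rule rayleigh_max_eigenvector[OF symR v])
  \<comment> \<open>For \<open>m = 0\<close> the eigenvector equation no longer forces
    \<open>v\<close> to be orthogonal to the earlier vectors, so the zero vector is recorded
    instead.\<close>
  define v' where "v' = (if m = 0 then (\<lambda>_. 0) else v)"
  have v'01: "ip W v' v' = 0 \<and> m = 0 \<or> ip W v' v' = 1"
    using v(1) by (auto simp: v'_def ip_def)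
  have eig': "bil W R y v' = m * ip W y v'" for y
    using eig by (auto simp: v'_def bil_def ip_def)
  have orth: "ip W (x i) v' = 0" if "i < k" for i
  proof (cases "m = 0")
    case True
    then show ?thesis by (simp add: v'_def ip_def)
  next
    case False
    have "m * ip W (x i) v = bil W R v (x i)" using eig[of "x i"] bil_commute[OF symR] by metis
    also have "\<dots> = 0" by (rule R(2)[OF that])
    finally show ?thesis using False by (simp add: v'_def)
  qed
  define \<mu>' where "\<mu>' = \<mu>(k := m)"
  define x' where "x' = x(k := v')"
  have old: "\<mu>' i = \<mu> i" "x' i = x i" if "i < k" for i using that by (auto simp: \<mu>'_def x'_def)
  have new: "\<mu>' k = m" "x' k = v'" by (auto simp: \<mu>'_def x'_def)
  have R': "remainder M (Suc k) \<mu>' x' = (\<lambda>u w. R u w - m * (v' u * v' w))"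
    by (simp add: R_def remainder_def old new diff_diff_eq cong: sum.cong_simp)
  have bilR': "bil W (\<lambda>u w. R u w - m * (v' u * v' w)) y z = bil W R y z - m * (ip W v' y * ip W v' z)" for y z
    by (simp add: bil_diff_mat bil_rank_one)
  have bound: "m * (ip W v' y * ip W v' y) \<le> bil W R y y" for y
  proof (cases "m = 0")
    case True
    then show ?thesis using bil_nonneg[OF R(1)] by simp
  next
    case False
    have "(m * ip W y v)\<^sup>2 \<le> bil W R y y * m"
      using bil_Cauchy_Schwarz[OF R(1), of y v] unfolding eig by (simp add: v(1))
    then have "m * (m * (ip W v y * ip W v y)) \<le> m * bil W R y y"
      by (simp add: power2_eq_square mult_ac ip_commute[of W y v])
    then show ?thesis using False m0 by (simp add: v'_def)
  qed
  have psd': "psd_on W (\<lambda>u w. R u w - m * (v' u * v' w))"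
    unfolding psd_on_iff_bil bilR'
    using symR bound by (auto simp: symmetric_on_def mult_ac)
  have "m \<le> \<mu> j" if "j < k" for j
    using R(3)[OF that, of v] v(1) by (simp add: m_def)
  then have mono: "\<mu>' i \<le> \<mu>' j" if "i < Suc k" "j < i" for i j
    using that ind(4) by (auto simp: less_Suc_eq old new)
  have ker: "bil W R y (x' i) - m * (ip W v' y * ip W v' (x' i)) = 0" if i: "i < Suc k" for i y
  proof (cases "i < k")
    case True
    then show ?thesis using R(2) orth by (simp add: old ip_commute[of W v' "x i"])
  next
    case False
    with i have "i = k" by simp
    then show ?thesis using v'01 eig'[of y] by (auto simp: new ip_commute[of W v' y])
  qed
  have top: "bil W R y y - m * (ip W v' y * ip W v' y) \<le> \<mu>' i * ip W y y" if "i < Suc k" for i y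
  proof -
    have "bil W R y y - m * (ip W v' y * ip W v' y) \<le> bil W R y y" using m0 by simp
    also have "\<dots> \<le> \<mu>' i * ip W y y"
      using that R(3) v(2) by (auto simp: less_Suc_eq old new m_def)
    finally show ?thesis .
  qed
  have "orth_sys W (Suc k) x'"
    unfolding x'_def using v'01 orth by (intro orth_sys_extend ind(1)) auto
  moreover have "0 \<le> \<mu>' i" "ip W (x' i) (x' i) = 0 \<longrightarrow> \<mu>' i = 0" if "i < Suc k" for i
    using that ind(2,3) m0 v'01 by (auto simp: less_Suc_eq old new)
  ultimately have "deflated W M (Suc k) \<mu>' x'"
    unfolding deflated_def R' bilR' using psd' mono ker top by blast
  then show ?case by blast
qed

text \<open>The sequences are infinite and padded by zeros, so sums of eigenvalues can be cut at any
  index without reference to the rank.\<close>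

locale spectral_decomposition =
  fixes W :: "'a set" and M :: "'a \<Rightarrow> 'a \<Rightarrow> real" and K :: nat and \<mu> :: "nat \<Rightarrow> real"
    and x :: "nat \<Rightarrow> 'a \<Rightarrow> real"
  assumes fin: "finite W"
    and mu_nonneg: "0 \<le> \<mu> i"
    and mu_antimono: "i \<le> j \<Longrightarrow> \<mu> j \<le> \<mu> i"
    and orth: "orth_sys W r x"
    and unit: "\<mu> i \<noteq> 0 \<Longrightarrow> ip W (x i) (x i) = 1"
    and mu_zero: "K \<le> i \<Longrightarrow> \<mu> i = 0"
    and decomp: "u \<in> W \<Longrightarrow> w \<in> W \<Longrightarrow> M u w = (\<Sum>i<K. \<mu> i * (x i u * x i w))"

text \<open>After one deflation step more than the dimension, some vector is zero and so is its
  eigenvalue. The remainder is then both nonnegative and nonpositive as a form, and Cauchy-Schwarz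
  makes all its entries 0.\<close>

theorem spectral_theorem:
  fixes M :: "'a \<Rightarrow> 'a \<Rightarrow> real"
  assumes fin: "finite W" and psd: "psd_on W M"
  obtains K \<mu> x where "spectral_decomposition W M K \<mu> x"
proof (cases "W = {}")
  case True
  have "spectral_decomposition W M 0 (\<lambda>_. 0) (\<lambda>_ _. 0)"
    using True by unfold_locales (auto simp: orth_sys_def ip_def)
  then show ?thesis by (rule that)
next
  case False
  define k where "k = Suc (card W)"
  obtain \<mu> x where defl: "deflated W M k \<mu> x"
    using deflation[OF fin False psd, of k] by blast
  define R where "R = remainder M k \<mu> x"
  have D: "orth_sys W k x" "\<And>i. i < k \<Longrightarrow> 0 \<le> \<mu> i"
      "\<And>i. i < k \<Longrightarrow> ip W (x i) (x i) = 0 \<Longrightarrow> \<mu> i = 0" "\<And>i j. i < k \<Longrightarrow> j < i \<Longrightarrow> \<mu> i \<le> \<mu> j"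
    and R1: "psd_on W R" and R3: "\<And>i y. i < k \<Longrightarrow> bil W R y y \<le> \<mu> i * ip W y y"
    using defl unfolding deflated_def R_def by auto
  have "\<exists>i<k. ip W (x i) (x i) = 0"
  proof (rule ccontr)
    assume "\<not> ?thesis"
    then have "ip W (x i) (x i) = 1" if "i < k" for i using D(1) that by (auto simp: orth_sys_def)
    then have "(\<Sum>i<k. ip W (x i) (x i)) = real k" by simp
    then show False using orth_sys_card[OF fin D(1)] by (simp add: k_def)
  qed
  then obtain i0 where i0: "i0 < k" "\<mu> i0 = 0" using D(3) by blast
  have Ryy: "bil W R y y \<le> 0" for y using R3[OF i0(1), of y] i0(2) by simp
  have R0: "R u w = 0" if "u \<in> W" "w \<in> W" for u w
  proof -
    let ?e = "\<lambda>a i. if i = a then 1 else 0 :: real"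
    have "bil W R (?e u) (?e u) = 0"
      using Ryy[of "?e u"] bil_nonneg[OF R1, of "?e u"] by simp
    then have "(bil W R (?e u) (?e w))\<^sup>2 \<le> 0"
      using bil_Cauchy_Schwarz[OF R1, of "?e u" "?e w"] by simp
    then show ?thesis using that by (simp add: bil_unit[OF fin])
  qed
  define \<mu>' where "\<mu>' = (\<lambda>i. if i < k then \<mu> i else 0)"
  define x' where "x' = (\<lambda>i u. if i < k then x i u else 0)"
  have x'1: "x' i = x i" if "i < k" for i using that by (simp add: x'_def)
  have x'0: "ip W (x' i) y = 0" "ip W y (x' i) = 0" if "\<not> i < k" for i y using that by (simp_all add: x'_def ip_def)
  have "spectral_decomposition W M k \<mu>' x'"
  proof
    show "finite W" by (rule fin)
    show "0 \<le> \<mu>' i" for i using D(2) by (simp add: \<mu>'_def)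
    show "\<mu>' j \<le> \<mu>' i" if "i \<le> j" for i j
      using D(2) D(4)[of j i] that by (cases "i = j") (auto simp: \<mu>'_def)
    show "orth_sys W r x'" for r
      unfolding orth_sys_def
    proof (intro conjI allI impI)
      fix i j :: nat assume "i \<noteq> j"
      then show "ip W (x' i) (x' j) = 0"
        using D(1) by (cases "i < k"; cases "j < k") (auto simp: orth_sys_def x'1 x'0)
    next
      fix i :: nat
      show "ip W (x' i) (x' i) = 0 \<or> ip W (x' i) (x' i) = 1"
        using D(1) by (cases "i < k") (auto simp: orth_sys_def x'1 x'0)
    qed
    show "ip W (x' i) (x' i) = 1" if "\<mu>' i \<noteq> 0" for i
      using that D(1,3) by (cases "i < k") (auto simp: orth_sys_def x'1 \<mu>'_def)
    show "\<mu>' i = 0" if "k \<le> i" for i using that by (simp add: \<mu>'_def)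
    show "M u w = (\<Sum>i<k. \<mu>' i * (x' i u * x' i w))" if "u \<in> W" "w \<in> W" for u w
      using R0[OF that] by (simp add: R_def remainder_def \<mu>'_def x'1 cong: sum.cong_simp)
  qed
  then show ?thesis by (rule that)
qed

text \<open>Expanding \<open>M\<close> in eigenvectors turns the form of the entrywise product at
  \<open>y\<close> into a nonnegative combination of values of the form of \<open>M'\<close> at the
  entrywise products of \<open>y\<close> with the eigenvectors.\<close>

theorem schur_product:
  assumes fin: "finite W" and "psd_on W M" "psd_on W M'"
  shows "psd_on W (\<lambda>i j. M i j * M' i j)"
proof -
  obtain K \<mu> x where "spectral_decomposition W M K \<mu> x" using spectral_theorem[OF fin assms(2)] .
  then interpret spectral_decomposition W M K \<mu> x .
  show ?thesis
    unfolding psd_on_iff_bil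
  proof (intro conjI allI)
    show "symmetric_on W (\<lambda>i j. M i j * M' i j)"
      using assms(2,3) by (simp add: psd_on_def symmetric_on_def)
    fix y
    have "bil W (\<lambda>i j. M i j * M' i j) y y = bil W (\<lambda>u w. \<Sum>i<K. \<mu> i * (x i u * x i w) * M' u w) y y"
      by (rule bil_cong) (simp add: decomp sum_distrib_right)
    also have "\<dots> = (\<Sum>i<K. \<mu> i * bil W M' (\<lambda>u. y u * x i u) (\<lambda>u. y u * x i u))"
      unfolding bil_sum_mat by (intro sum.cong refl) (simp add: bil_def sum_distrib_left mult_ac)
    also have "\<dots> \<ge> 0"
      by (intro sum_nonneg mult_nonneg_nonneg mu_nonneg bil_nonneg[OF assms(3)])
    finally show "0 \<le> bil W (\<lambda>i j. M i j * M' i j) y y" .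
  qed
qed

section \<open>Sums of the largest eigenvalues\<close>

lemma psd_on_diag_nonneg: "finite W \<Longrightarrow> psd_on W M \<Longrightarrow> u \<in> W \<Longrightarrow> 0 \<le> M u u"
  using bil_nonneg[of W M "\<lambda>i. if i = u then 1 else 0"] by (simp add: bil_unit)

lemma psd_on_entry_sq:
  assumes "finite V" "psd_on V M" "i \<in> V" "j \<in> V"
  shows "(M i j)\<^sup>2 \<le> M i i * M j j"
  using bil_Cauchy_Schwarz[OF assms(2), of "\<lambda>k. if k = i then 1 else 0" "\<lambda>k. if k = j then 1 else 0"] assms
  by (simp add: bil_unit)

lemma psd_on_add: "psd_on W M \<Longrightarrow> psd_on W M' \<Longrightarrow> psd_on W (\<lambda>u w. M u w + M' u w)"
  by (auto simp: psd_on_iff_bil symmetric_on_def bil_add_mat)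

lemma psd_on_cong:
  assumes "\<And>u w. u \<in> W \<Longrightarrow> w \<in> W \<Longrightarrow> M u w = M' u w" "psd_on W M"
  shows "psd_on W M'"
proof -
  have "bil W M' y y = bil W M y y" for y by (rule bil_cong) (simp add: assms(1))
  then show ?thesis using assms by (auto simp: psd_on_iff_bil symmetric_on_def)
qed

text \<open>Pairs are coded as two-digit numbers in base \<open>f\<close>, because orthogonal
  systems are indexed by natural numbers.\<close>

lemma sum_div_mod:
  fixes g :: "nat \<Rightarrow> nat \<Rightarrow> 'b::comm_monoid_add"
  shows "(\<Sum>k<f * f. g (k div f) (k mod f)) = (\<Sum>i<f. \<Sum>j<f. g i j)"
proof -
  have lt: "i * f + j < f * f" if "i < f" "j < f" for i j
  proof -
    have "i * f + j < Suc i * f" using that by simp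
    also have "\<dots> \<le> f * f" using that by (intro mult_right_mono) auto
    finally show ?thesis .
  qed
  have "(\<Sum>k<f * f. g (k div f) (k mod f)) = (\<Sum>(i, j)\<in>{..<f} \<times> {..<f}. g i j)"
    by (rule sum.reindex_bij_witness[of _ "\<lambda>(i, j). i * f + j" "\<lambda>k. (k div f, k mod f)"])
      (auto simp: lt less_mult_imp_div_less intro!: mod_less_divisor gr0I)
  then show ?thesis by (simp add: sum.cartesian_product)
qed

context spectral_decomposition
begin

definition partial :: "nat \<Rightarrow> 'a \<Rightarrow> 'a \<Rightarrow> real" where
  "partial f u w = (\<Sum>i<f. \<mu> i * (x i u * x i w))"

lemma ip_x_le_1: "ip W (x i) (x i) \<le> 1"
  using orth[of "Suc i"] by (auto simp: orth_sys_def)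

text \<open>The upper limit \<open>max f K\<close> covers the case \<open>K \<le> f\<close> as well,
  where the sum is empty.\<close>

lemma rest:
  assumes "u \<in> W" "w \<in> W"
  shows "M u w - partial f u w = (\<Sum>i\<in>{f..<max f K}. \<mu> i * (x i u * x i w))"
proof -
  have "M u w = (\<Sum>i<max f K. \<mu> i * (x i u * x i w))"
    unfolding decomp[OF assms] by (rule sum.mono_neutral_left) (auto simp: mu_zero)
  also have "\<dots> = partial f u w + (\<Sum>i\<in>{f..<max f K}. \<mu> i * (x i u * x i w))"
    unfolding partial_def lessThan_atLeast0 by (rule sum.atLeastLessThan_concat[symmetric]) auto
  finally show ?thesis by simp
qed

lemma psd_partial: "psd_on W (partial f)"
  using psd_on_rank_one_sum[of "{..<f}" \<mu> W x] mu_nonneg by (simp add: partial_def[abs_def])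

lemma psd_rest: "psd_on W (\<lambda>u w. M u w - partial f u w)"
  by (rule psd_on_cong[OF _ psd_on_rank_one_sum[of "{f..<max f K}" \<mu> W x]])
    (auto simp: rest mu_nonneg)

lemma psd_M: "psd_on W M"
  by (rule psd_on_cong[OF _ psd_on_rank_one_sum[of "{..<K}" \<mu> W x]]) (auto simp: decomp mu_nonneg)

lemma sum_partial_diag: "(\<Sum>u\<in>W. partial f u u) = (\<Sum>i<f. \<mu> i)"
proof -
  have "(\<Sum>u\<in>W. partial f u u) = (\<Sum>i<f. \<Sum>u\<in>W. \<mu> i * (x i u * x i u))"
    unfolding partial_def by (rule sum.swap)
  also have "\<dots> = (\<Sum>i<f. \<mu> i * ip W (x i) (x i))"
    by (simp add: ip_def sum_distrib_left)
  also have "\<dots> = (\<Sum>i<f. \<mu> i)"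
  proof (rule sum.cong[OF refl])
    fix i show "\<mu> i * ip W (x i) (x i) = \<mu> i" using unit[of i] by (cases "\<mu> i = 0") auto
  qed
  finally show ?thesis .
qed

lemma sum_mu_le_trace: "(\<Sum>i<f. \<mu> i) \<le> (\<Sum>u\<in>W. M u u)"
  unfolding sum_partial_diag[symmetric]
  by (intro sum_mono) (use psd_on_diag_nonneg[OF fin psd_rest] in force)

lemma bil_M: "bil W M y y = (\<Sum>i<K. \<mu> i * (ip W (x i) y)\<^sup>2)"
proof -
  have "bil W M y y = bil W (\<lambda>u w. \<Sum>i<K. \<mu> i * (x i u * x i w)) y y"
    by (rule bil_cong) (rule decomp)
  then show ?thesis by (simp add: bil_sum_mat bil_rank_one power2_eq_square)
qed

text \<open>Ky Fan's maximum principle. The form sums to an average of the eigenvalues with weights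
  \<open>q i\<close> between 0 and 1 of total at most \<open>r\<close>, and such an average is
  largest when the weight sits on the first \<open>r\<close> eigenvalues.\<close>

lemma ky_fan:
  assumes "orth_sys W r y"
  shows "(\<Sum>k<r. bil W M (y k) (y k)) \<le> (\<Sum>i<r. \<mu> i)"
proof -
  define q where "q i = (\<Sum>k<r. (ip W (x i) (y k))\<^sup>2)" for i
  have q0: "0 \<le> q i" for i by (simp add: q_def sum_nonneg)
  have q1: "q i \<le> 1" for i
    using bessel[OF fin assms, of "x i"] ip_x_le_1[of i] by (simp add: q_def)
  have "(\<Sum>i<K. q i) = (\<Sum>k<r. \<Sum>i<K. (ip W (y k) (x i))\<^sup>2)"
    unfolding q_def by (subst sum.swap) (simp add: ip_commute)
  also have "\<dots> \<le> (\<Sum>k<r. 1)"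
  proof (rule sum_mono)
    fix k assume "k \<in> {..<r}"
    then have "ip W (y k) (y k) \<le> 1" using assms by (auto simp: orth_sys_def)
    then show "(\<Sum>i<K. (ip W (y k) (x i))\<^sup>2) \<le> 1" using bessel[OF fin orth[of K], of "y k"] by linarith
  qed
  finally have qr: "(\<Sum>i<K. q i) \<le> real r" by simp
  \<comment> \<open>Subtracting this threshold makes the coefficients nonnegative for
    \<open>i < r\<close> and nonpositive from \<open>r\<close> on, so each \<open>q i\<close> can be
    replaced by 1 or 0 separately.\<close>
  define m where "m = \<mu> r"
  have "(\<Sum>k<r. bil W M (y k) (y k)) = (\<Sum>i<K. \<mu> i * q i)"
    unfolding bil_M q_def sum_distrib_left by (rule sum.swap)
  also have "\<dots> = (\<Sum>i<K. (\<mu> i - m) * q i) + m * (\<Sum>i<K. q i)"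
    by (simp add: sum_distrib_left sum.distrib[symmetric] algebra_simps)
  also have "\<dots> \<le> (\<Sum>i<K. if i < r then \<mu> i - m else 0) + m * real r"
  proof (intro add_mono sum_mono mult_left_mono qr)
    fix i
    show "(\<mu> i - m) * q i \<le> (if i < r then \<mu> i - m else 0)"
    proof (cases "i < r")
      case True
      then show ?thesis using mu_antimono[of i r] q1[of i] mult_left_mono[of "q i" 1 "\<mu> i - m"]
        by (simp add: m_def)
    next
      case False
      then show ?thesis using mu_antimono[of r i] q0[of i] by (simp add: m_def mult_nonpos_nonneg)
    qed
  qed (simp add: m_def mu_nonneg)
  also have "(\<Sum>i<K. if i < r then \<mu> i - m else 0) = (\<Sum>i\<in>{..<K} \<inter> {..<r}. \<mu> i - m)"
    by (simp add: sum.inter_restrict)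
  also have "\<dots> \<le> (\<Sum>i<r. \<mu> i - m)"
    by (rule sum_mono2) (use mu_antimono[of _ r] in \<open>auto simp: m_def\<close>)
  also have "(\<Sum>i<r. \<mu> i - m) + m * real r = (\<Sum>i<r. \<mu> i)" by (simp add: sum_subtractf)
  finally show ?thesis by simp
qed

text \<open>Orthogonality of the eigenvectors kills the cross terms in the expanded square.\<close>

lemma frobenius_rest:
  "(\<Sum>u\<in>W. \<Sum>w\<in>W. (M u w - partial f u w)\<^sup>2) \<le> (\<Sum>i\<in>{f..<max f K}. (\<mu> i)\<^sup>2)"
proof -
  let ?I = "{f..<max f K}"
  have "(\<Sum>u\<in>W. \<Sum>w\<in>W. (M u w - partial f u w)\<^sup>2)
      = (\<Sum>u\<in>W. \<Sum>w\<in>W. \<Sum>i\<in>?I. \<Sum>j\<in>?I. (\<mu> i * (x i u * x i w)) * (\<mu> j * (x j u * x j w)))"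
    by (intro sum.cong refl) (simp only: rest power2_eq_square sum_product)
  also have "\<dots> = (\<Sum>u\<in>W. \<Sum>i\<in>?I. \<Sum>w\<in>W. \<Sum>j\<in>?I. (\<mu> i * (x i u * x i w)) * (\<mu> j * (x j u * x j w)))"
    by (intro sum.cong refl) (rule sum.swap)
  also have "\<dots> = (\<Sum>i\<in>?I. \<Sum>u\<in>W. \<Sum>j\<in>?I. \<Sum>w\<in>W. (\<mu> i * (x i u * x i w)) * (\<mu> j * (x j u * x j w)))"
    by (subst sum.swap) (intro sum.cong refl sum.swap)
  also have "\<dots> = (\<Sum>i\<in>?I. \<Sum>j\<in>?I. \<Sum>u\<in>W. \<Sum>w\<in>W. (\<mu> i * (x i u * x i w)) * (\<mu> j * (x j u * x j w)))"
    by (intro sum.cong refl sum.swap)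
  also have "\<dots> = (\<Sum>i\<in>?I. \<Sum>j\<in>?I. \<mu> i * \<mu> j * (ip W (x i) (x j) * ip W (x i) (x j)))"
  proof (intro sum.cong refl)
    fix i j
    have "ip W (x i) (x j) * ip W (x i) (x j) = (\<Sum>u\<in>W. \<Sum>w\<in>W. (x i u * x j u) * (x i w * x j w))"
      unfolding ip_def by (rule sum_product)
    then show "(\<Sum>u\<in>W. \<Sum>w\<in>W. (\<mu> i * (x i u * x i w)) * (\<mu> j * (x j u * x j w))) =
        \<mu> i * \<mu> j * (ip W (x i) (x j) * ip W (x i) (x j))"
      by (simp add: sum_distrib_left mult_ac)
  qed
  also have "\<dots> \<le> (\<Sum>i\<in>?I. \<Sum>j\<in>?I. if j = i then (\<mu> i)\<^sup>2 else 0)"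
  proof (intro sum_mono)
    fix i j
    show "\<mu> i * \<mu> j * (ip W (x i) (x j) * ip W (x i) (x j)) \<le> (if j = i then (\<mu> i)\<^sup>2 else 0)"
    proof (cases "i = j")
      case True
      have "ip W (x i) (x i) * ip W (x i) (x i) \<le> 1 * 1"
        by (intro mult_mono ip_x_le_1 ip_nonneg) auto
      then show ?thesis using True mult_left_mono[of _ 1 "\<mu> i * \<mu> i"] by (simp add: power2_eq_square)
    next
      case False
      then have "ip W (x i) (x j) = 0"
        using orth[of "Suc (max i j)"] by (auto simp: orth_sys_def)
      then show ?thesis using False by simp
    qed
  qed
  also have "\<dots> = (\<Sum>i\<in>?I. (\<mu> i)\<^sup>2)" by simp
  finally show ?thesis .
qed

end

section \<open>Shifted 0/1 matrices and the decay of their eigenvalues\<close>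

locale zero_one_matrix =
  fixes A :: "'a \<Rightarrow> 'a \<Rightarrow> real"
  assumes A01: "A u v = 0 \<or> A u v = 1" and A_sym: "A u v = A v u" and A_diag: "A u u = 0"

definition shifted :: "('a \<Rightarrow> 'a \<Rightarrow> real) \<Rightarrow> real \<Rightarrow> 'a \<Rightarrow> 'a \<Rightarrow> real" where
  "shifted A l u v = A u v + (if u = v then l else 0)"

lemma bil_scaled_identity: "finite W \<Longrightarrow> bil W (\<lambda>u v. if u = v then c else 0) y y = c * ip W y y"
  by (simp add: bil_def ip_def sum_distrib_left if_distrib[where f="\<lambda>a. _ * a * _"] mult_ac
      if_distrib[where f="\<lambda>a. _ * a"] cong: if_cong)

locale shifted_spectrum = zero_one_matrix A + spectral_decomposition W "shifted A l" K \<mu> x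
  for A :: "'a \<Rightarrow> 'a \<Rightarrow> real" and W l K \<mu> x +
  assumes l_ge_1: "1 \<le> l"
begin

lemma trace_shifted: "(\<Sum>u\<in>W. shifted A l u u) = l * real (card W)"
  by (simp add: shifted_def A_diag)

text \<open>The Hadamard square of a 0/1 matrix is the matrix itself, whereas it squares the rank of the
  truncation \<open>partial f\<close>.\<close>

lemma eigenvalue_sum_recursion:
  "(\<Sum>i<f. \<mu> i)\<^sup>2 \<le> real (card W) * ((\<Sum>i<f * f. \<mu> i) + l\<^sup>2 * real (f * f))"
proof -
  let ?B = "shifted A l" and ?L = "partial f"
  define z where "z k = (\<lambda>u. x (k div f) u * x (k mod f) u)" for k
  define c where "c k = \<mu> (k div f) * \<mu> (k mod f)" for k
  \<comment> \<open>The Hadamard square of \<open>?L\<close> is a combination of the rank-one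
    matrices of the \<open>f * f\<close> products \<open>z k\<close>, so its trace is recovered
    along a system \<open>y\<close> of that length.\<close>
  obtain y where y: "orth_sys W (f * f) y"
    and yz: "\<And>k. k < f * f \<Longrightarrow> (\<Sum>j<f * f. (ip W (z k) (y j))\<^sup>2) = ip W (z k) (z k)"
    using gram_schmidt[OF fin, of "f * f" z] by blast
  have LL: "?L u w * ?L u w = (\<Sum>k<f * f. c k * (z k u * z k w))" for u w
  proof -
    have "?L u w * ?L u w = (\<Sum>i<f. \<Sum>j<f. \<mu> i * \<mu> j * ((x i u * x j u) * (x i w * x j w)))"
      unfolding partial_def sum_product by (intro sum.cong refl) (simp add: mult_ac)
    then show ?thesis
      by (simp add: sum_div_mod[of "\<lambda>i j. \<mu> i * \<mu> j * ((x i u * x j u) * (x i w * x j w))", symmetric] c_def z_def)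
  qed
  \<comment> \<open>Squaring fixes the entries 0 and 1 off the diagonal and turns \<open>l\<close>
    into \<open>l\<^sup>2\<close> on it.\<close>
  have bilB2: "bil W (\<lambda>u w. ?B u w * ?B u w) v v = bil W ?B v v + (l\<^sup>2 - l) * ip W v v" for v
  proof -
    have "bil W (\<lambda>u w. ?B u w * ?B u w) v v
        = bil W (\<lambda>u w. ?B u w + (if u = w then l\<^sup>2 - l else 0)) v v"
    proof (rule bil_cong)
      fix u w
      show "?B u w * ?B u w = ?B u w + (if u = w then l\<^sup>2 - l else 0)"
        using A01[of u w] by (auto simp: shifted_def A_diag power2_eq_square)
    qed
    then show ?thesis by (simp add: bil_add_mat bil_scaled_identity[OF fin])
  qed
  \<comment> \<open>The difference of the entrywise squares, factored as \<open>?B - ?L\<close>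
    times \<open>?B + ?L\<close> and written as a sum of Schur products of semidefinite
    matrices.\<close>
  have "psd_on W (\<lambda>u w. (?B u w - ?L u w) * ?B u w + (?B u w - ?L u w) * ?L u w)"
    by (intro psd_on_add schur_product[OF fin] psd_rest psd_partial psd_M)
  then have "psd_on W (\<lambda>u w. ?B u w * ?B u w - ?L u w * ?L u w)"
    by (rule psd_on_cong[rotated]) (simp add: algebra_simps)
  from bil_nonneg[OF this] have cmp: "bil W (\<lambda>u w. ?L u w * ?L u w) v v \<le> bil W (\<lambda>u w. ?B u w * ?B u w) v v" for v
    by (simp add: bil_diff_mat)
  have "(\<Sum>i<f. \<mu> i)\<^sup>2 = (\<Sum>u\<in>W. ?L u u)\<^sup>2" by (simp add: sum_partial_diag)
  also have "\<dots> \<le> real (card W) * (\<Sum>u\<in>W. ?L u u * ?L u u)"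
    using Cauchy_Schwarz_ineq_sum[of "\<lambda>_. 1" "\<lambda>u. ?L u u" W] by (simp add: power2_eq_square)
  also have "(\<Sum>u\<in>W. ?L u u * ?L u u) = (\<Sum>k<f * f. c k * ip W (z k) (z k))"
    unfolding LL by (subst sum.swap) (simp add: ip_def sum_distrib_left)
  also have "\<dots> = (\<Sum>k<f * f. \<Sum>j<f * f. c k * (ip W (z k) (y j))\<^sup>2)"
    by (intro sum.cong refl) (simp add: yz[symmetric] sum_distrib_left)
  also have "\<dots> = (\<Sum>j<f * f. bil W (\<lambda>u w. ?L u w * ?L u w) (y j) (y j))"
    unfolding LL bil_sum_mat bil_rank_one by (subst sum.swap) (simp add: power2_eq_square)
  also have "\<dots> \<le> (\<Sum>j<f * f. bil W ?B (y j) (y j) + l\<^sup>2)"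
  proof (rule sum_mono)
    fix j assume "j \<in> {..<f * f}"
    then have 1: "ip W (y j) (y j) \<le> 1" using y by (auto simp: orth_sys_def)
    have "(l\<^sup>2 - l) * ip W (y j) (y j) \<le> (l\<^sup>2 - l) * 1"
      using l_ge_1 by (intro mult_left_mono 1) (simp add: power2_eq_square)
    also have "\<dots> \<le> l\<^sup>2" using l_ge_1 by simp
    finally show "bil W (\<lambda>u w. ?L u w * ?L u w) (y j) (y j) \<le> bil W ?B (y j) (y j) + l\<^sup>2"
      using cmp[of "y j"] unfolding bilB2 by linarith
  qed
  also have "\<dots> \<le> (\<Sum>i<f * f. \<mu> i) + l\<^sup>2 * real (f * f)"
    using ky_fan[OF y] by (simp add: sum.distrib)
  finally show ?thesis by (simp add: mult_left_mono)
qed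

text \<open>While \<open>f \<le> l ^ 4\<close>, the error term of the recursion is at most 1 after
  normalisation, and the recursion becomes \<open>(b f)\<^sup>2 \<le> b (f * f)\<close>. From
  \<open>l ^ 4\<close> on, the trace bound \<open>b f \<le> l\<close> already gives
  \<open>(b f) ^ 4 \<le> f\<close>; the recursion carries this from \<open>f * f\<close> down to
  \<open>f\<close>.\<close>

lemma eigenvalue_sum_bound:
  assumes N: "l ^ 10 \<le> real (card W)" and "2 \<le> f"
  shows "(\<Sum>i<f. \<mu> i) ^ 4 \<le> 16 * real f * real (card W) ^ 4"
proof -
  define N where "N = real (card W)"
  have "1 \<le> l ^ 10" using l_ge_1 by simp
  then have N1: "N \<ge> 1" using N by (simp add: N_def)
  define s where "s f = (\<Sum>i<f. \<mu> i) / N" for f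
  \<comment> \<open>The maximum with 1 and the factor 1/2 absorb the additive constant in
    \<open>(s f)\<^sup>2 \<le> s (f * f) + 1\<close>.\<close>
  define b where "b f = max 1 (s f) / 2" for f
  have b0: "0 \<le> b f" for f by (simp add: b_def)
  have s_le: "s f \<le> l" for f
    using sum_mu_le_trace[of f] N1 unfolding trace_shifted by (simp add: s_def N_def field_simps)
  have step: "(b f)\<^sup>2 \<le> b (f * f)" if "real f \<le> l ^ 4" for f
  proof -
    have s0: "0 \<le> s f" unfolding s_def using N1 by (intro divide_nonneg_nonneg sum_nonneg mu_nonneg) auto
    have "l\<^sup>2 * (real f * real f) \<le> l\<^sup>2 * (l ^ 4 * l ^ 4)"
      using that by (intro mult_left_mono mult_mono) auto
    also have "\<dots> = l ^ 10" by (simp flip: power_add)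
    finally have "l\<^sup>2 * real (f * f) \<le> N" using N by (simp add: N_def)
    then have "(\<Sum>i<f. \<mu> i)\<^sup>2 \<le> N * ((\<Sum>i<f * f. \<mu> i) + N)"
      using eigenvalue_sum_recursion[of f] N1 mult_left_mono[of "(\<Sum>i<f * f. \<mu> i) + l\<^sup>2 * real (f * f)" "(\<Sum>i<f * f. \<mu> i) + N" N]
      unfolding N_def by linarith
    then have "(s f)\<^sup>2 \<le> s (f * f) + 1"
      using N1 by (simp add: s_def power_divide power2_eq_square field_simps)
    moreover have "(max 1 (s f))\<^sup>2 \<le> max 1 ((s f)\<^sup>2)"
      by (cases "s f \<le> 1") (auto simp: max_def)
    ultimately have "(max 1 (s f))\<^sup>2 \<le> 2 * max 1 (s (f * f))" by linarith
    then show ?thesis by (simp add: b_def power_divide)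
  qed
  have "(b f) ^ 4 \<le> real f" if "2 \<le> f" for f
    using that
  proof (induction "nat \<lceil>l ^ 4\<rceil> - f" arbitrary: f rule: less_induct)
    case less
    show ?case
    proof (cases "l ^ 4 \<le> real f")
      case True
      have "b f \<le> l" using s_le[of f] l_ge_1 by (simp add: b_def)
      then have "(b f) ^ 4 \<le> l ^ 4" by (intro power_mono b0)
      then show ?thesis using True by simp
    next
      case False
      then have lt: "f < nat \<lceil>l ^ 4\<rceil>" by linarith
      have "f < f * f" using less.prems by simp
      then have "nat \<lceil>l ^ 4\<rceil> - f * f < nat \<lceil>l ^ 4\<rceil> - f" "2 \<le> f * f" using less.prems lt by linarith+
      then have "(b (f * f)) ^ 4 \<le> real (f * f)" by (rule less.hyps)
      moreover have "((b f)\<^sup>2) ^ 4 \<le> (b (f * f)) ^ 4"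
        using step[of f] False by (intro power_mono) auto
      ultimately have "((b f) ^ 4)\<^sup>2 \<le> (real f)\<^sup>2"
        by (simp add: power2_eq_square[of "real f"] flip: power_mult)
      then show ?thesis by (rule power2_le_imp_le) simp
    qed
  qed
  from this[OF assms(2)] have "(max 1 (s f)) ^ 4 \<le> 16 * real f" by (simp add: b_def power_divide)
  moreover have "(s f) ^ 4 \<le> (max 1 (s f)) ^ 4"
    unfolding s_def using N1 by (intro power_mono divide_nonneg_nonneg sum_nonneg mu_nonneg) auto
  ultimately have "(s f) ^ 4 \<le> 16 * real f" by linarith
  then show ?thesis using N1 by (simp add: s_def power_divide field_simps N_def)
qed

text \<open>Indices start at 0 and eigenvalues decrease, so \<open>i * \<mu> i\<close> is at most
  the sum of the first \<open>i\<close> of them. The resulting exponent -3/2 is summable.\<close>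

lemma eigenvalue_bound:
  assumes N: "l ^ 10 \<le> real (card W)" and i: "2 \<le> i"
  shows "(\<mu> i)\<^sup>2 \<le> 4 * (real (card W))\<^sup>2 * real i powr (-3/2)"
proof -
  have "real i * \<mu> i = (\<Sum>j<i. \<mu> i)" by simp
  also have "\<dots> \<le> (\<Sum>j<i. \<mu> j)" by (intro sum_mono mu_antimono) auto
  finally have "(real i * \<mu> i) ^ 4 \<le> (\<Sum>j<i. \<mu> j) ^ 4"
    by (intro power_mono) (simp_all add: mu_nonneg)
  also have "\<dots> \<le> 16 * real i * real (card W) ^ 4" by (rule eigenvalue_sum_bound[OF N i])
  finally have *: "(real i) ^ 4 * (\<mu> i) ^ 4 \<le> 16 * real i * real (card W) ^ 4"
    by (simp add: power_mult_distrib)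
  have r: "(real i powr (-3/2))\<^sup>2 = 1 / real i ^ 3"
  proof -
    have "(real i powr (-3/2))\<^sup>2 = real i powr (-3/2 + -3/2)"
      by (simp only: power2_eq_square powr_add)
    also have "\<dots> = real i powr (-3)" by simp
    also have "\<dots> = 1 / real i ^ 3" using i by (intro powr_neg_numeral) simp
    finally show ?thesis .
  qed
  have "(\<mu> i) ^ 4 \<le> 16 * real (card W) ^ 4 / real i ^ 3"
    using * i by (simp add: field_simps power_numeral_reduce)
  also have "\<dots> = (4 * (real (card W))\<^sup>2 * real i powr (-3/2))\<^sup>2"
    unfolding power_mult_distrib r by (simp flip: power_mult)
  finally have "((\<mu> i)\<^sup>2)\<^sup>2 \<le> (4 * (real (card W))\<^sup>2 * real i powr (-3/2))\<^sup>2"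
    by (simp flip: power_mult)
  then show ?thesis by (rule power2_le_imp_le) simp
qed

lemma frobenius_tail:
  assumes N: "l ^ 10 \<le> real (card W)" and F: "2 \<le> F"
    and tail: "\<And>m. (\<Sum>i\<in>{F..<m}. real i powr (-3/2)) \<le> \<delta>"
  shows "(\<Sum>u\<in>W. \<Sum>w\<in>W. (shifted A l u w - partial F u w)\<^sup>2) \<le> 4 * \<delta> * (real (card W))\<^sup>2"
proof -
  have "(\<Sum>u\<in>W. \<Sum>w\<in>W. (shifted A l u w - partial F u w)\<^sup>2) \<le> (\<Sum>i\<in>{F..<max F K}. (\<mu> i)\<^sup>2)"
    by (rule frobenius_rest)
  also have "\<dots> \<le> (\<Sum>i\<in>{F..<max F K}. 4 * (real (card W))\<^sup>2 * real i powr (-3/2))"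
    using F by (intro sum_mono eigenvalue_bound[OF N]) auto
  also have "\<dots> = 4 * (real (card W))\<^sup>2 * (\<Sum>i\<in>{F..<max F K}. real i powr (-3/2))"
    by (simp add: sum_distrib_left)
  also have "\<dots> \<le> 4 * (real (card W))\<^sup>2 * \<delta>" by (intro mult_left_mono tail) auto
  finally show ?thesis by (simp add: mult_ac)
qed

end

text \<open>The truncation rank \<open>F\<close> depends on \<delta> alone, which makes all later
  rank bounds uniform over graphs.\<close>

lemma powr_tail_small:
  assumes "0 < (\<delta>::real)"
  obtains F :: nat where "2 \<le> F" "\<And>m. (\<Sum>i\<in>{F..<m}. real i powr (-3/2)) \<le> \<delta>"
proof -
  have "summable (\<lambda>n. real n powr (-3/2))" by (subst summable_real_powr_iff) simp
  then obtain N where N: "\<And>m n. N \<le> m \<Longrightarrow> norm (\<Sum>i\<in>{m..<n}. real i powr (-3/2)) < \<delta>"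
    unfolding summable_Cauchy using assms by blast
  show ?thesis
  proof (rule that[of "max 2 N"])
    fix m
    show "(\<Sum>i\<in>{max 2 N..<m}. real i powr (-3/2)) \<le> \<delta>"
      using N[of "max 2 N" m] by simp
  qed simp
qed

section \<open>Large cliques in dense graphs\<close>

context spectral_decomposition
begin

text \<open>The spectral embedding: the first \<open>f\<close> coordinates of the vertices have Gram
  matrix \<open>partial f\<close>, so vertices that are close in it have similar entries.\<close>

definition coord :: "'a \<Rightarrow> nat \<Rightarrow> real" where
  "coord u i = sqrt (\<mu> i) * x i u"

lemma partial_coord: "partial f u w = (\<Sum>i<f. coord u i * coord w i)"
proof -
  have "\<mu> i * (x i u * x i w) = coord u i * coord w i" for i
  proof -
    have "coord u i * coord w i = (sqrt (\<mu> i) * sqrt (\<mu> i)) * (x i u * x i w)"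
      unfolding coord_def by (simp only: mult_ac)
    then show ?thesis using mu_nonneg[of i] by simp
  qed
  then show ?thesis by (simp add: partial_def)
qed

lemma partial_polarization:
  "2 * partial f u w = partial f u u + partial f w w - (\<Sum>i<f. (coord u i - coord w i)\<^sup>2)"
  unfolding partial_coord
  by (simp add: power2_eq_square algebra_simps sum.distrib sum_subtractf sum_distrib_left)

lemma coord_sq_le: "i < f \<Longrightarrow> (coord u i)\<^sup>2 \<le> partial f u u"
  unfolding partial_coord power2_eq_square
  by (rule member_le_sum[of i "{..<f}" "\<lambda>i. coord u i * coord u i"]) auto

end

lemma sum_eq_card_support:
  assumes "finite S" "\<And>p. p \<in> S \<Longrightarrow> g p = 0 \<or> g p = (1::real)"
  shows "sum g S = real (card {p \<in> S. g p = 1})"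
proof -
  have "sum g S = (\<Sum>p\<in>S. if g p = 1 then 1 else 0)"
    using assms(2) by (intro sum.cong refl) auto
  then show ?thesis using assms(1) by (simp add: sum.inter_filter[symmetric])
qed

lemma card_split: "finite X \<Longrightarrow> Y \<subseteq> X \<Longrightarrow> real (card X) = real (card Y) + real (card (X - Y))"
  by (simp add: card_Diff_subset card_mono finite_subset of_nat_diff)

lemma floor_eq_abs_diff_le:
  fixes a b \<rho> :: real
  assumes "\<lfloor>a / \<rho>\<rfloor> = \<lfloor>b / \<rho>\<rfloor>" "0 < \<rho>"
  shows "\<bar>a - b\<bar> \<le> \<rho>"
proof -
  have "\<bar>a / \<rho> - b / \<rho>\<bar> \<le> 1" using assms(1) by linarith
  moreover have "a / \<rho> - b / \<rho> = (a - b) / \<rho>" by (simp add: diff_divide_distrib)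
  ultimately show ?thesis using assms(2) by (simp add: abs_divide)
qed

context shifted_spectrum
begin

text \<open>The Frobenius bound leaves at least half of the edges with an entry of
  \<open>partial F\<close> of at least 99/100. By Cauchy-Schwarz each of these has an endpoint with
  an equally large diagonal entry, and few diagonal entries exceed \<open>C\<close> because the
  trace is bounded.\<close>

lemma many_large_diagonal:
  assumes "0 < \<epsilon>" "l ^ 10 \<le> real (card W)" and F: "2 \<le> F"
    and tail: "\<And>m. (\<Sum>i\<in>{F..<m}. real i powr (-3/2)) \<le> \<epsilon> / 80000"
    and e: "\<epsilon> * (real (card W))\<^sup>2 \<le> (\<Sum>u\<in>W. \<Sum>w\<in>W. A u w)"
    and C: "16 * real F / \<epsilon> \<le> C"
  shows "\<epsilon> / 8 * real (card W) \<le> real (card {u \<in> W. 99/100 \<le> partial F u u \<and> partial F u u \<le> C})"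
proof -
  define N where "N = real (card W)"
  let ?L = "partial F"
  have "1 \<le> l ^ 10" using l_ge_1 by simp
  then have N1: "N \<ge> 1" using assms by (simp add: N_def)
  define E where "E = {p \<in> W \<times> W. A (fst p) (snd p) = 1}"
  define Gd where "Gd = {p \<in> E. 99/100 \<le> ?L (fst p) (snd p)}"
  define X where "X = {u \<in> W. 99/100 \<le> ?L u u}"
  define Y where "Y = {u \<in> W. 99/100 \<le> ?L u u \<and> ?L u u \<le> C}"
  have finE: "finite E" "finite X" "finite Y" using fin by (auto simp: E_def X_def Y_def)
  have "(\<Sum>u\<in>W. \<Sum>w\<in>W. A u w) = (\<Sum>p\<in>W \<times> W. A (fst p) (snd p))"
    by (simp add: sum.cartesian_product case_prod_beta)
  also have "\<dots> = real (card E)" unfolding E_def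
    using fin A01 by (intro sum_eq_card_support) auto
  finally have cardE: "\<epsilon> * N\<^sup>2 \<le> real (card E)" using e by (simp add: N_def)
  \<comment> \<open>Each edge outside \<open>Gd\<close> costs at least
    \<open>(1/100)\<^sup>2\<close> of a total error of
    \<open>4 * (\<epsilon> / 80000) * N\<^sup>2\<close>; this is the origin of 80000.\<close>
  have "real (card (E - Gd)) * (1/10000) = (\<Sum>p\<in>E - Gd. 1/10000)" by simp
  also have "\<dots> \<le> (\<Sum>p\<in>E - Gd. (shifted A l (fst p) (snd p) - ?L (fst p) (snd p))\<^sup>2)"
  proof (rule sum_mono)
    fix p assume p: "p \<in> E - Gd"
    then have "A (fst p) (snd p) = 1" "?L (fst p) (snd p) < 99/100" by (auto simp: E_def Gd_def)
    moreover from this have "fst p \<noteq> snd p" using A_diag[of "fst p"] by auto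
    ultimately have "1/100 \<le> shifted A l (fst p) (snd p) - ?L (fst p) (snd p)" by (simp add: shifted_def)
    from power_mono[OF this, of 2] show "1/10000 \<le> (shifted A l (fst p) (snd p) - ?L (fst p) (snd p))\<^sup>2"
      by (simp add: power2_eq_square)
  qed
  also have "\<dots> \<le> (\<Sum>p\<in>W \<times> W. (shifted A l (fst p) (snd p) - ?L (fst p) (snd p))\<^sup>2)"
    using fin by (intro sum_mono2) (auto simp: E_def)
  also have "\<dots> = (\<Sum>u\<in>W. \<Sum>w\<in>W. (shifted A l u w - ?L u w)\<^sup>2)"
    by (simp add: sum.cartesian_product case_prod_beta)
  also have "\<dots> \<le> 4 * (\<epsilon> / 80000) * N\<^sup>2"
    unfolding N_def by (rule frobenius_tail[OF assms(2) F tail])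
  finally have bad: "real (card (E - Gd)) \<le> \<epsilon> / 2 * N\<^sup>2" by simp
  have "real (card E) = real (card Gd) + real (card (E - Gd))"
    by (rule card_split[OF finE(1)]) (auto simp: Gd_def)
  then have good: "\<epsilon> / 2 * N\<^sup>2 \<le> real (card Gd)" using cardE bad by linarith
  have "Gd \<subseteq> X \<times> W \<union> W \<times> X"
  proof
    fix p assume p: "p \<in> Gd"
    then obtain u w where uw: "p = (u, w)" "u \<in> W" "w \<in> W" "99/100 \<le> ?L u w" by (auto simp: Gd_def E_def)
    have "(99/100) * (99/100) \<le> ?L u u * ?L w w"
      using psd_on_entry_sq[OF fin psd_partial uw(2,3), of F] power_mono[OF uw(4), of 2] by (simp add: power2_eq_square)
    then have "99/100 \<le> ?L u u \<or> 99/100 \<le> ?L w w"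
      using psd_on_diag_nonneg[OF fin psd_partial uw(2), of F] psd_on_diag_nonneg[OF fin psd_partial uw(3), of F]
        mult_strict_mono'[of "?L u u" "99/100" "?L w w" "99/100"] by linarith
    then show "p \<in> X \<times> W \<union> W \<times> X" using uw by (auto simp: X_def)
  qed
  then have "card Gd \<le> card (X \<times> W \<union> W \<times> X)" using fin finE by (intro card_mono) auto
  also have "\<dots> \<le> card (X \<times> W) + card (W \<times> X)" by (rule card_Un_le)
  finally have "card Gd \<le> 2 * card X * card W" by (simp add: card_cartesian_product mult_ac)
  then have "real (card Gd) \<le> real (2 * card X * card W)" by (simp only: of_nat_le_iff)
  then have "real (card Gd) \<le> 2 * real (card X) * N" by (simp add: N_def)
  with good have "N * (\<epsilon> / 2 * N) \<le> N * (2 * real (card X))" by (simp add: power2_eq_square mult_ac)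
  then have X: "\<epsilon> / 4 * N \<le> real (card X)" using N1 by simp
  have Fpos: "real F > 0" using F by simp
  have C0: "C > 0" using C assms(1) Fpos by (smt (verit) divide_pos_pos)
  have "(\<Sum>i<F. \<mu> i) ^ 4 \<le> 16 * real F * N ^ 4" unfolding N_def by (rule eigenvalue_sum_bound[OF assms(2) F])
  also have "\<dots> \<le> 16 * real F ^ 4 * N ^ 4"
    using F N1 power_increasing[of 1 4 "real F"] by (intro mult_right_mono) auto
  also have "\<dots> = (2 * real F * N) ^ 4" by (simp add: power_mult_distrib)
  finally have SF: "(\<Sum>i<F. \<mu> i) \<le> 2 * real F * N" by (rule power_le_imp_le_base[where n=3, simplified]) (use N1 in simp)
  \<comment> \<open>Markov's inequality for the diagonal, whose sum is at most
    \<open>2 * real F * N\<close>; with \<open>C\<close> at least \<open>16 * F / \<epsilon>\<close>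
    it discards at most half of the guaranteed size of \<open>X\<close>.\<close>
  have "real (card (X - Y)) * C = (\<Sum>u\<in>X - Y. C)" by simp
  also have "\<dots> \<le> (\<Sum>u\<in>X - Y. ?L u u)" by (intro sum_mono) (auto simp: X_def Y_def)
  also have "\<dots> \<le> (\<Sum>u\<in>W. ?L u u)"
    using fin psd_on_diag_nonneg[OF fin psd_partial] by (intro sum_mono2) (auto simp: X_def)
  also have "\<dots> \<le> 2 * real F * N" using SF by (simp add: sum_partial_diag)
  finally have "real (card (X - Y)) * C \<le> 2 * real F * N" .
  also have "\<dots> \<le> (\<epsilon> / 8 * N) * C"
  proof -
    have "16 * real F \<le> C * \<epsilon>" using C assms(1) by (simp add: field_simps)
    then have "16 * real F * N \<le> C * \<epsilon> * N" using N1 by (intro mult_right_mono) auto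
    then show ?thesis by (simp add: mult_ac)
  qed
  finally have "real (card (X - Y)) \<le> \<epsilon> / 8 * N" using C0 by simp
  moreover have "real (card X) = real (card Y) + real (card (X - Y))"
    by (rule card_split[OF finE(2)]) (auto simp: X_def Y_def)
  ultimately have "\<epsilon> / 8 * N \<le> real (card Y)" using X by linarith
  then show ?thesis by (simp add: Y_def N_def)
qed

text \<open>Pigeonhole over the cells of a grid of side \<open>\<rho>\<close> in the spectral
  embedding. Within one cell, polarization keeps all entries of \<open>partial F\<close> above
  98/100.\<close>

lemma dense_cluster:
  assumes \<epsilon>: "0 < \<epsilon>" and N: "l ^ 10 \<le> real (card W)" and F: "2 \<le> F"
    and tail: "\<And>m. (\<Sum>i\<in>{F..<m}. real i powr (-3/2)) \<le> \<epsilon> / 80000"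
    and e: "\<epsilon> * (real (card W))\<^sup>2 \<le> (\<Sum>u\<in>W. \<Sum>w\<in>W. A u w)"
    and C: "16 * real F / \<epsilon> \<le> C" "1 \<le> C"
    and m: "C * (10 * real F) + 1 \<le> real m"
  shows "\<exists>P\<subseteq>W. \<epsilon> / 8 * real (card W) \<le> real (card P) * real ((2 * m + 1) ^ F) \<and>
    98/100 * (real (card P))\<^sup>2 \<le> (\<Sum>u\<in>P. \<Sum>w\<in>P. A u w) + l * real (card P)"
proof -
  let ?L = "partial F"
  define Y where "Y = {u \<in> W. 99/100 \<le> ?L u u \<and> ?L u u \<le> C}"
  \<comment> \<open>Two points of a cell have squared distance at most
    \<open>F * \<rho>\<^sup>2 \<le> 1/100\<close>, so the entries are at least 99/100 -
    1/200.\<close>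
  define \<rho> where "\<rho> = 1 / (10 * real F)"
  have \<rho>: "0 < \<rho>" using F by (simp add: \<rho>_def)
  define T where "T = PiE {..<F} (\<lambda>_. {- int m..int m})"
  define h where "h u = restrict (\<lambda>i. \<lfloor>coord u i / \<rho>\<rfloor>) {..<F}" for u
  have cardT: "card T = (2 * m + 1) ^ F"
  proof -
    have "nat (2 * int m + 1) = 2 * m + 1" by (simp add: nat_eq_iff)
    then show ?thesis by (simp add: T_def card_PiE)
  qed
  have finT: "finite T" by (auto simp: T_def intro!: finite_PiE)
  have "T \<noteq> {}" by (auto simp: T_def PiE_eq_empty_iff)
  have finY: "finite Y" using fin by (simp add: Y_def)
  have "h \<in> Y \<rightarrow> T"
  proof
    fix u assume u: "u \<in> Y"
    have "\<lfloor>coord u i / \<rho>\<rfloor> \<in> {- int m..int m}" if "i < F" for i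
    proof -
      have "(coord u i)\<^sup>2 \<le> C" using coord_sq_le[OF that, of u] u by (simp add: Y_def)
      also have "C \<le> C\<^sup>2" using C(2) by (simp add: power2_eq_square)
      finally have "\<bar>coord u i\<bar> \<le> C" using C(2) by (simp add: abs_le_square_iff[symmetric])
      moreover have "coord u i / \<rho> = coord u i * (10 * real F)" by (simp add: \<rho>_def)
      moreover have "\<bar>coord u i * (10 * real F)\<bar> = \<bar>coord u i\<bar> * (10 * real F)" by (simp add: abs_mult)
      moreover have "\<bar>coord u i\<bar> * (10 * real F) \<le> C * (10 * real F)"
        using \<open>\<bar>coord u i\<bar> \<le> C\<close> by (intro mult_right_mono) auto
      ultimately have "\<bar>coord u i / \<rho>\<bar> \<le> real m - 1" using m by linarith
      then have "- real m \<le> coord u i / \<rho>" "coord u i / \<rho> < real m + 1" by linarith+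
      then show ?thesis by (simp add: floor_le_iff le_floor_iff)
    qed
    then show "h u \<in> T" by (auto simp: h_def T_def)
  qed
  from pigeonhole_card[OF this finY finT \<open>T \<noteq> {}\<close>] obtain c
    where c: "card Y \<le> card (h -` {c} \<inter> Y) * card T" by blast
  define P where "P = h -` {c} \<inter> Y"
  have PW: "P \<subseteq> W" by (auto simp: P_def Y_def)
  have L_ge: "98/100 \<le> ?L u w" if "u \<in> P" "w \<in> P" for u w
  proof -
    have hh: "h u = h w" using that by (simp add: P_def)
    have "(coord u i - coord w i)\<^sup>2 \<le> \<rho>\<^sup>2" if "i < F" for i
    proof -
      have "\<lfloor>coord u i / \<rho>\<rfloor> = \<lfloor>coord w i / \<rho>\<rfloor>" using fun_cong[OF hh, of i] that by (simp add: h_def)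
      from floor_eq_abs_diff_le[OF this \<rho>] show ?thesis using \<rho> by (simp add: abs_le_square_iff[symmetric])
    qed
    then have "(\<Sum>i<F. (coord u i - coord w i)\<^sup>2) \<le> (\<Sum>i<F. \<rho>\<^sup>2)" by (intro sum_mono) auto
    also have "\<dots> = 1 / (100 * real F)" by (simp add: \<rho>_def power2_eq_square)
    also have "\<dots> \<le> 1 / 100" using F by simp
    finally show ?thesis using partial_polarization[of F u w] that by (simp add: P_def Y_def)
  qed
  \<comment> \<open>Testing this form on the all-ones vector converts large entries of
    \<open>?L\<close> into many edges inside \<open>P\<close>.\<close>
  have "psd_on P (\<lambda>u w. shifted A l u w - ?L u w)" by (rule psd_on_subset[OF psd_rest PW fin])
  from bil_nonneg[OF this, of "\<lambda>_. 1"]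
  have "(\<Sum>u\<in>P. \<Sum>w\<in>P. ?L u w) \<le> (\<Sum>u\<in>P. \<Sum>w\<in>P. shifted A l u w)"
    by (simp add: bil_def sum_subtractf)
  moreover have "98/100 * (real (card P))\<^sup>2 = (\<Sum>u\<in>P. \<Sum>w\<in>P. 98/100)" by (simp add: power2_eq_square)
  moreover have "\<dots> \<le> (\<Sum>u\<in>P. \<Sum>w\<in>P. ?L u w)" by (intro sum_mono L_ge)
  moreover have "(\<Sum>u\<in>P. \<Sum>w\<in>P. shifted A l u w) = (\<Sum>u\<in>P. \<Sum>w\<in>P. A u w) + l * real (card P)"
    using finite_subset[OF PW fin] by (simp add: shifted_def sum.distrib)
  moreover have "\<epsilon> / 8 * real (card W) \<le> real (card P) * real ((2 * m + 1) ^ F)"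
  proof -
    have "\<epsilon> / 8 * real (card W) \<le> real (card Y)"
      unfolding Y_def by (rule many_large_diagonal[OF \<epsilon> N F tail e C(1)])
    also have "\<dots> \<le> real (card P * card T)" using c unfolding P_def by (simp only: of_nat_le_iff)
    finally show ?thesis by (simp add: cardT)
  qed
  ultimately show ?thesis using PW by auto
qed

end

section \<open>Removing non-edges and extracting a clique\<close>

context zero_one_matrix
begin

lemma nonadj_nonneg: "0 \<le> 1 - A u w"
  using A01[of u w] by auto

text \<open>Markov's inequality: at most half of the vertices have more than twice the average
  number of non-neighbours allowed by the density. A vertex counts as its own non-neighbour
  here.\<close>

lemma prune:
  assumes fin: "finite P" and l: "200 * l \<le> real (card P)"
    and d: "98/100 * (real (card P))\<^sup>2 \<le> (\<Sum>u\<in>P. \<Sum>w\<in>P. A u w) + l * real (card P)"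
  shows "\<exists>P'\<subseteq>P. card P \<le> 2 * card P' \<and> (\<forall>u\<in>P'. (\<Sum>w\<in>P'. 1 - A u w) \<le> real (card P') / 10)"
proof -
  define p where "p = real (card P)"
  define n where "n u = (\<Sum>w\<in>P. 1 - A u w)" for u
  have n0: "0 \<le> n u" for u unfolding n_def by (intro sum_nonneg nonadj_nonneg)
  define P' where "P' = {u \<in> P. n u \<le> p / 20}"
  have P'P: "P' \<subseteq> P" by (auto simp: P'_def)
  \<comment> \<open>The non-edges then amount to at most (2/100 + 1/200) \<open>p * p\<close>, which
    is \<open>p * p / 40\<close>.\<close>
  have "l * p \<le> p / 200 * p" using l by (intro mult_right_mono) (auto simp: p_def)
  then have "(\<Sum>u\<in>P. n u) \<le> p * p / 40"
    using d by (simp add: n_def sum_subtractf p_def power2_eq_square)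
  have "real (card (P - P')) * (p / 20) = (\<Sum>u\<in>P - P'. p / 20)" by simp
  also have "\<dots> \<le> (\<Sum>u\<in>P - P'. n u)" by (intro sum_mono) (auto simp: P'_def)
  also have "\<dots> \<le> (\<Sum>u\<in>P. n u)" using fin n0 by (intro sum_mono2) auto
  also have "\<dots> \<le> p * p / 40" by fact
  finally have *: "p * (2 * real (card (P - P'))) \<le> p * p" by simp
  have "2 * real (card (P - P')) \<le> p"
  proof (cases "p = 0")
    case True
    then show ?thesis using fin by (simp add: p_def)
  next
    case False
    then have "p > 0" by (simp add: p_def)
    then show ?thesis using * by simp
  qed
  moreover have "p = real (card P') + real (card (P - P'))"
    unfolding p_def by (rule card_split[OF fin P'P])
  ultimately have half: "p \<le> 2 * real (card P')" by linarith
  have "(\<Sum>w\<in>P'. 1 - A u w) \<le> real (card P') / 10" if "u \<in> P'" for u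
  proof -
    have "(\<Sum>w\<in>P'. 1 - A u w) \<le> n u" unfolding n_def using fin P'P nonadj_nonneg by (intro sum_mono2) auto
    also have "\<dots> \<le> p / 20" using that by (simp add: P'_def)
    finally show ?thesis using half by linarith
  qed
  moreover have "card P \<le> 2 * card P'" using half by (simp add: p_def)
  ultimately show ?thesis using P'P by blast
qed

text \<open>In the application \<open>a\<close> and \<open>b\<close> are the fractions of
  non-neighbours of \<open>u\<close> and \<open>w\<close>, \<open>e\<close> is \<open>l\<close> over
  the number of vertices, and \<open>t\<close> is the entry of the all-ones component. At an edge
  \<open>1 - t\<close> is at most \<open>a + b + e \<le> 21/100\<close>, which cubing shrinks below
  a twentieth of itself; at a non-edge \<open>t \<ge> 8/10\<close> gives a cube below -1/2.\<close>

lemma cube_entry_bound: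
  fixes a b e t l :: real
  assumes "0 \<le> a" "a \<le> 1/10" "0 \<le> b" "b \<le> 1/10" "0 \<le> e" "e \<le> 1/100" "0 \<le> l"
    and t: "(1 - a) * (1 - b) / (1 + e) \<le> t"
  shows "(shifted A l u w - t) ^ 3 \<le> (a + b + e) / 20 - (1 - A u w) / 2 + (if u = w then l ^ 3 + 1/2 else 0)"
proof -
  have "(9/10) * (9/10) \<le> (1 - a) * (1 - b)" using assms by (intro mult_mono) auto
  then have "(81/100) / (101/100) \<le> (1 - a) * (1 - b) / (1 + e)" using assms by (intro frac_le) auto
  then have t8: "8/10 \<le> t" using t by simp
  have s0: "0 \<le> a + b + e" using assms by simp
  have "(1 - t) \<le> a + b + e"
  proof -
    have "(1 - a - b) * (1 + e) \<le> (1 - a) * (1 - b) + e * 1"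
    proof -
      have "(1 - a - b) * e \<le> 1 * e" using assms by (intro mult_right_mono) auto
      moreover have "0 \<le> a * b" using assms by simp
      ultimately show ?thesis by (simp add: algebra_simps)
    qed
    moreover have "(1 - a - b - e) * (1 + e) = (1 - a - b) * (1 + e) - e - e * e"
      by (simp add: algebra_simps)
    ultimately have "(1 - a - b - e) * (1 + e) \<le> (1 - a) * (1 - b)"
      using zero_le_square[of e] by linarith
    then have "1 - a - b - e \<le> (1 - a) * (1 - b) / (1 + e)" using assms by (simp add: pos_le_divide_eq)
    then show ?thesis using t by linarith
  qed
  then have "(1 - t) ^ 3 \<le> (a + b + e) ^ 3" by (intro power_mono_odd) auto
  also have "\<dots> = (a + b + e)\<^sup>2 * (a + b + e)" by (simp add: power2_eq_square power3_eq_cube)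
  also have "\<dots> \<le> (21/100)\<^sup>2 * (a + b + e)"
    using assms s0 by (intro mult_right_mono power_mono) auto
  also have "\<dots> \<le> (a + b + e) / 20" using s0 by (simp add: power2_eq_square)
  finally have edge: "(1 - t) ^ 3 \<le> (a + b + e) / 20" .
  have "(8/10) ^ 3 \<le> t ^ 3" using t8 by (intro power_mono) auto
  then have nonedge: "(- t) ^ 3 \<le> - (1/2)" by (simp add: power3_eq_cube)
  have diag: "(l - t) ^ 3 \<le> l ^ 3" using t8 by (intro power_mono_odd) auto
  show ?thesis
  proof (cases "u = w")
    case True
    \<comment> \<open>The extra 1/2 on the diagonal offsets \<open>(1 - A u u) / 2\<close>, since
      the diagonal counts as a non-edge.\<close>
    have "(l - t) ^ 3 \<le> (a + b + e) / 20 + l ^ 3" using diag s0 by (intro add_increasing) auto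
    then show ?thesis using True by (simp add: shifted_def A_diag)
  next
    case False
    have "(- t) ^ 3 \<le> (a + b + e) / 20 - 1 / 2"
      by (rule order_trans[OF nonedge]) (use s0 in simp)
    then show ?thesis using A01[of u w] edge False by (auto simp: shifted_def)
  qed
qed

text \<open>After removal of the component of the all-ones vector, the sum of the cubed entries is still
  non-negative; in a graph of density more than 1/2 the non-edges contribute negatively.\<close>

lemma few_nonedges:
  assumes fin: "finite P" and psd: "psd_on P (shifted A l)" and l: "1 \<le> l" "100 * l \<le> real (card P)"
    and deg: "\<And>u. u \<in> P \<Longrightarrow> (\<Sum>w\<in>P. 1 - A u w) \<le> real (card P) / 10"
  shows "(\<Sum>u\<in>P. \<Sum>w\<in>P. 1 - A u w) \<le> 4 * l ^ 3 * real (card P)"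
proof -
  define p where "p = real (card P)"
  have p: "100 * l \<le> p" "p > 0" using l by (auto simp: p_def)
  define n where "n u = (\<Sum>w\<in>P. 1 - A u w)" for u
  define Q where "Q = (\<Sum>u\<in>P. n u)"
  define r where "r u = (\<Sum>w\<in>P. shifted A l u w)" for u
  define T where "T = (\<Sum>u\<in>P. r u)"
  let ?one = "\<lambda>_::'a. 1::real"
  have n0: "0 \<le> n u" for u unfolding n_def by (intro sum_nonneg nonadj_nonneg)
  have n1: "n u \<le> p / 10" if "u \<in> P" for u using deg[OF that] by (simp add: n_def p_def)
  have r: "r u = p - n u + l" if "u \<in> P" for u
    using that fin by (simp add: r_def n_def shifted_def sum.distrib sum_subtractf p_def)
  have T_eq: "T = p * p + l * p - Q"
    by (simp add: T_def r sum.distrib sum_subtractf p_def Q_def algebra_simps)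
  have Q0: "0 \<le> Q" unfolding Q_def by (intro sum_nonneg n0)
  have "Q \<le> (\<Sum>u\<in>P. p / 10)" unfolding Q_def by (intro sum_mono n1)
  then have "Q \<le> p * p / 10" by (simp add: p_def)
  moreover have "0 < p * p" "0 < l * p" using p l by auto
  ultimately have T0: "T > 0" unfolding T_eq by linarith
  \<comment> \<open>Schur complement along the all-ones vector: \<open>r\<close> is the image of
    that vector and \<open>T\<close> the value of the form at it.\<close>
  define B' where "B' = (\<lambda>u w. shifted A l u w - (1 / T) * (r u * r w))"
  have psd': "psd_on P B'"
    unfolding psd_on_iff_bil
  proof (intro conjI allI)
    show "symmetric_on P B'" using psd by (auto simp: B'_def symmetric_on_def psd_on_def)
    fix y
    have br: "bil P (shifted A l) y ?one = ip P r y"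
      by (simp add: bil_def ip_def r_def sum_distrib_left sum_distrib_right mult_ac)
    have "(ip P r y)\<^sup>2 \<le> bil P (shifted A l) y y * bil P (shifted A l) ?one ?one"
      using bil_Cauchy_Schwarz[OF psd, of y ?one] unfolding br .
    also have "bil P (shifted A l) ?one ?one = T" by (simp add: bil_def T_def r_def)
    finally have "(ip P r y)\<^sup>2 / T \<le> bil P (shifted A l) y y" using T0 by (simp add: pos_divide_le_eq)
    then show "0 \<le> bil P B' y y"
      unfolding B'_def bil_diff_mat bil_rank_one by (simp add: power2_eq_square)
  qed
  \<comment> \<open>The odd power preserves both semidefiniteness and the negative sign of the
    entries at non-edges.\<close>
  have "psd_on P (\<lambda>u w. B' u w * (B' u w * B' u w))"
    by (intro schur_product[OF fin] psd')
  from bil_nonneg[OF this, of ?one] have "0 \<le> (\<Sum>u\<in>P. \<Sum>w\<in>P. (B' u w) ^ 3)"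
    by (simp add: bil_def power3_eq_cube mult.assoc)
  also have "\<dots> \<le> (\<Sum>u\<in>P. \<Sum>w\<in>P. (n u / p + n w / p + l / p) / 20 - (1 - A u w) / 2 + (if u = w then l ^ 3 + 1/2 else 0))"
  proof (intro sum_mono)
    fix u w assume u: "u \<in> P" and w: "w \<in> P"
    have "(1 - n u / p) * (1 - n w / p) / (1 + l / p) = (p - n u) * (p - n w) / (p * p + l * p)"
    proof -
      have "1 - n u / p = (p - n u) / p" "1 - n w / p = (p - n w) / p" "1 + l / p = (p * p + l * p) / (p * p)"
        using p by (simp_all add: diff_divide_distrib add_divide_distrib)
      then show ?thesis using p by simp
    qed
    also have "\<dots> \<le> r u * r w / T"
    proof (rule frac_le)
      have "0 \<le> p - n u" "0 \<le> p - n w" using n1[OF u] n1[OF w] p by linarith+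
      then show "(p - n u) * (p - n w) \<le> r u * r w" "0 \<le> r u * r w"
        using r[OF u] r[OF w] l by (auto intro!: mult_mono)
      show "T \<le> p * p + l * p" using T_eq Q0 by simp
    qed (rule T0)
    finally have "(1 - n u / p) * (1 - n w / p) / (1 + l / p) \<le> (1 / T) * (r u * r w)" by simp
    then show "(B' u w) ^ 3 \<le> (n u / p + n w / p + l / p) / 20 - (1 - A u w) / 2 + (if u = w then l ^ 3 + 1/2 else 0)"
      unfolding B'_def using p l n0[of u] n0[of w] n1[OF u] n1[OF w]
      by (intro cube_entry_bound) (auto simp: field_simps)
  qed
  also have "\<dots> = (2 * Q + l * p) / 20 - Q / 2 + p * (l ^ 3 + 1/2)"
  proof -
    have 1: "(\<Sum>u\<in>P. \<Sum>w\<in>P. n u / p) = Q" using p by (simp add: Q_def p_def sum_distrib_left)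
    have 2: "(\<Sum>u\<in>P. \<Sum>w\<in>P. n w / p) = Q"
      using p by (simp add: Q_def p_def sum_divide_distrib[symmetric])
    have 3: "(\<Sum>u\<in>P. \<Sum>w\<in>P. l / p) = l * p" using p by (simp add: p_def)
    have 4: "(\<Sum>u\<in>P. \<Sum>w\<in>P. (1 - A u w) / 2) = Q / 2"
      unfolding Q_def n_def by (simp only: sum_divide_distrib)
    have 5: "(\<Sum>u\<in>P. \<Sum>w\<in>P. if u = w then l ^ 3 + 1/2 else 0) = p * (l ^ 3 + 1/2)"
      using fin by (simp add: p_def)
    have "(\<Sum>u\<in>P. \<Sum>w\<in>P. (n u / p + n w / p + l / p) / 20 - (1 - A u w) / 2 + (if u = w then l ^ 3 + 1/2 else 0))
      = ((\<Sum>u\<in>P. \<Sum>w\<in>P. n u / p) + (\<Sum>u\<in>P. \<Sum>w\<in>P. n w / p) + (\<Sum>u\<in>P. \<Sum>w\<in>P. l / p)) / 20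
        - (\<Sum>u\<in>P. \<Sum>w\<in>P. (1 - A u w) / 2) + (\<Sum>u\<in>P. \<Sum>w\<in>P. if u = w then l ^ 3 + 1/2 else 0)"
      by (simp only: sum.distrib sum_subtractf sum_divide_distrib[symmetric])
    then show ?thesis unfolding 1 2 3 4 5 by simp
  qed
  finally have "0 \<le> (2 * Q + l * p) / 20 - Q / 2 + p * (l ^ 3 + 1/2)" .
  \<comment> \<open>Non-edges are charged \<open>Q / 2\<close> and the edge terms return only
    \<open>2 * Q / 20\<close>, leaving 2/5 of \<open>Q\<close>.\<close>
  moreover have "2/5 * Q \<le> y / 20 + z" if "0 \<le> (2 * Q + y) / 20 - Q / 2 + z" for y z
    using that by (simp add: field_simps)
  ultimately have "2/5 * Q \<le> l * p / 20 + p * (l ^ 3 + 1/2)" by blast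
  also have "\<dots> = p * (l / 20 + l ^ 3 + 1/2)" by (simp add: algebra_simps)
  also have "\<dots> \<le> p * (8/5 * l ^ 3)"
  proof -
    have "l \<le> l ^ 3" "1 \<le> l ^ 3" using l power_increasing[of 1 3 l] by auto
    then have "l / 20 + l ^ 3 + 1/2 \<le> 8/5 * l ^ 3" by linarith
    then show ?thesis using p by (intro mult_left_mono) auto
  qed
  finally show ?thesis by (simp add: Q_def n_def p_def mult_ac)
qed

definition is_clique :: "'a set \<Rightarrow> bool" where
  "is_clique C \<longleftrightarrow> (\<forall>u\<in>C. \<forall>v\<in>C. u \<noteq> v \<longrightarrow> A u v = 1)"

text \<open>Half of the vertices have at most \<open>2 * D\<close> non-neighbours. In a maximal
  clique among them, every such vertex is a non-neighbour of some member (of itself, if it is a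
  member), so the clique covers them with sets of size at most \<open>2 * D\<close>.\<close>

lemma clique_of_sparse_complement:
  assumes fin: "finite P" and D: "0 < D" and "(\<Sum>u\<in>P. \<Sum>w\<in>P. 1 - A u w) \<le> D * real (card P)"
  shows "\<exists>C\<subseteq>P. is_clique C \<and> real (card P) \<le> 4 * D * real (card C)"
proof -
  define n where "n u = (\<Sum>w\<in>P. 1 - A u w)" for u
  have n0: "0 \<le> n u" for u unfolding n_def by (intro sum_nonneg nonadj_nonneg)
  define P' where "P' = {u \<in> P. n u \<le> 2 * D}"
  have P': "P' \<subseteq> P" "finite P'" using fin by (auto simp: P'_def)
  have "real (card (P - P')) * (2 * D) = (\<Sum>u\<in>P - P'. 2 * D)" by simp
  also have "\<dots> \<le> (\<Sum>u\<in>P - P'. n u)" by (intro sum_mono) (auto simp: P'_def)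
  also have "\<dots> \<le> (\<Sum>u\<in>P. n u)" using fin n0 by (intro sum_mono2) auto
  also have "\<dots> \<le> D * real (card P)" using assms(3) by (simp add: n_def)
  finally have "D * (2 * real (card (P - P'))) \<le> D * real (card P)" by (simp only: mult_ac)
  then have "2 * real (card (P - P')) \<le> real (card P)" using D by simp
  moreover have "real (card P) = real (card P') + real (card (P - P'))"
    by (rule card_split[OF fin P'(1)])
  ultimately have half: "real (card P) \<le> 2 * real (card P')" by linarith
  define \<C> where "\<C> = {C. C \<subseteq> P' \<and> is_clique C}"
  have "finite \<C>" using P'(2) by (auto simp: \<C>_def)
  moreover have "{} \<in> \<C>" by (simp add: \<C>_def is_clique_def)
  ultimately obtain C where C: "C \<in> \<C>" "\<And>C'. C' \<in> \<C> \<Longrightarrow> C \<subseteq> C' \<Longrightarrow> C = C'"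
    using finite_has_maximal[of \<C>] by blast
  have CP: "C \<subseteq> P'" "is_clique C" using C(1) by (auto simp: \<C>_def)
  have finC: "finite C" using CP P' finite_subset by blast
  have cover: "P' \<subseteq> (\<Union>c\<in>C. {u \<in> P'. A c u = 0})"
  proof
    fix u assume u: "u \<in> P'"
    show "u \<in> (\<Union>c\<in>C. {u \<in> P'. A c u = 0})"
    proof (rule ccontr)
      assume no: "u \<notin> (\<Union>c\<in>C. {u \<in> P'. A c u = 0})"
      then have 1: "A c u = 1" if "c \<in> C" for c using that u A01[of c u] by auto
      then have "u \<notin> C" using A_diag[of u] by force
      have "A u c = 1" if "c \<in> C" for c using 1[OF that] A_sym[of u c] by simp
      then have "is_clique (insert u C)"
        using CP(2) 1 by (auto simp: is_clique_def)
      then have "insert u C \<in> \<C>" using u CP(1) by (simp add: \<C>_def)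
      then show False using C(2)[of "insert u C"] \<open>u \<notin> C\<close> by blast
    qed
  qed
  have "real (card {u \<in> P'. A c u = 0}) \<le> 2 * D" if "c \<in> C" for c
  proof -
    have "real (card {u \<in> P'. A c u = 0}) = (\<Sum>u\<in>{u \<in> P'. A c u = 0}. 1 - A c u)" by simp
    also have "\<dots> \<le> n c" unfolding n_def using fin P' nonadj_nonneg by (intro sum_mono2) auto
    also have "\<dots> \<le> 2 * D" using that CP(1) by (auto simp: P'_def)
    finally show ?thesis .
  qed
  then have "(\<Sum>c\<in>C. real (card {u \<in> P'. A c u = 0})) \<le> (\<Sum>c\<in>C. 2 * D)" by (intro sum_mono)
  moreover have "card P' \<le> (\<Sum>c\<in>C. card {u \<in> P'. A c u = 0})"
  proof -
    have "finite (\<Union>c\<in>C. {u \<in> P'. A c u = 0})" using finC P'(2) by auto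
    from card_mono[OF this cover] show ?thesis
      using card_UN_le[OF finC, of "\<lambda>c. {u \<in> P'. A c u = 0}"] by linarith
  qed
  then have "real (card P') \<le> (\<Sum>c\<in>C. real (card {u \<in> P'. A c u = 0}))"
    by (simp flip: of_nat_sum)
  ultimately have "real (card P') \<le> 2 * D * real (card C)" by (simp add: mult_ac)
  then have "real (card P) \<le> 4 * D * real (card C)" using half by linarith
  then show ?thesis using CP P'(1) by blast
qed

end

text \<open>The rank \<open>F\<close>, the diagonal cap \<open>C\<close> and the grid size
  \<open>m\<close> are fixed from \<epsilon> before the matrix is given, so \<kappa> is
  uniform.\<close>

theorem large_clique:
  fixes \<epsilon> :: real
  assumes "0 < \<epsilon>"
  shows "\<exists>\<kappa>>0. \<forall>(A :: 'a \<Rightarrow> 'a \<Rightarrow> real) W l. zero_one_matrix A \<longrightarrow> finite W \<longrightarrow>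
    psd_on W (shifted A l) \<longrightarrow> 1 \<le> l \<longrightarrow> l ^ 10 \<le> \<kappa> * real (card W) \<longrightarrow>
    \<epsilon> * (real (card W))\<^sup>2 \<le> (\<Sum>u\<in>W. \<Sum>w\<in>W. A u w) \<longrightarrow>
    (\<exists>C\<subseteq>W. zero_one_matrix.is_clique A C \<and> 40 * l ^ 3 \<le> real (card C))"
proof -
  obtain F :: nat where F: "2 \<le> F" and tail: "\<And>m. (\<Sum>i\<in>{F..<m}. real i powr (-3/2)) \<le> \<epsilon> / 80000"
    using powr_tail_small[of "\<epsilon> / 80000"] assms by auto
  define C where "C = 16 * real F / \<epsilon> + 1"
  have C: "16 * real F / \<epsilon> \<le> C" "1 \<le> C" using assms by (simp_all add: C_def)
  define m where "m = nat \<lceil>C * (10 * real F) + 1\<rceil>"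
  have m: "C * (10 * real F) + 1 \<le> real m" unfolding m_def by (rule real_nat_ceiling_ge)
  define M where "M = real ((2 * m + 1) ^ F)"
  have M: "M \<ge> 1" unfolding M_def by simp
  \<comment> \<open>\<open>M\<close> is the number of grid cells, so the cluster gets at least
    \<open>1280 * l ^ 10\<close> vertices. Pruning halves this and passing to a clique divides by
    \<open>16 * l ^ 3\<close>, which leaves \<open>40 * l ^ 3\<close>. The minimum with 1 secures
    \<open>l ^ 10 \<le> card W\<close>.\<close>
  define \<kappa> where "\<kappa> = min 1 (\<epsilon> / (8 * M * 1280))"
  have \<kappa>: "0 < \<kappa>" using assms M by (simp add: \<kappa>_def)
  have "\<exists>C\<subseteq>W. zero_one_matrix.is_clique A C \<and> 40 * l ^ 3 \<le> real (card C)"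
    if zo: "zero_one_matrix A" and fin: "finite W" and psd: "psd_on W (shifted A l)" and l: "1 \<le> l"
      and N: "l ^ 10 \<le> \<kappa> * real (card W)"
      and e: "\<epsilon> * (real (card W))\<^sup>2 \<le> (\<Sum>u\<in>W. \<Sum>w\<in>W. A u w)"
    for A :: "'a \<Rightarrow> 'a \<Rightarrow> real" and W l
  proof -
    interpret zero_one_matrix A by (rule zo)
    obtain K \<mu> x where sd: "spectral_decomposition W (shifted A l) K \<mu> x"
      using spectral_theorem[OF fin psd] .
    interpret shifted_spectrum A W l K \<mu> x
      using sd l by (simp add: shifted_spectrum_def shifted_spectrum_axioms_def zero_one_matrix_axioms)
    have "\<kappa> * real (card W) \<le> 1 * real (card W)" by (intro mult_right_mono) (auto simp: \<kappa>_def)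
    then have N1: "l ^ 10 \<le> real (card W)" using N by simp
    from dense_cluster[OF assms N1 F tail e C m] obtain P
      where P: "P \<subseteq> W" "\<epsilon> / 8 * real (card W) \<le> real (card P) * M"
        "98/100 * (real (card P))\<^sup>2 \<le> (\<Sum>u\<in>P. \<Sum>w\<in>P. A u w) + l * real (card P)"
      unfolding M_def by blast
    have finP: "finite P" using P(1) fin finite_subset by blast
    have "1280 * M * l ^ 10 \<le> 1280 * M * (\<kappa> * real (card W))" using N M by (intro mult_left_mono) auto
    also have "\<dots> \<le> 1280 * M * (\<epsilon> / (8 * M * 1280) * real (card W))"
      using M by (intro mult_left_mono mult_right_mono) (auto simp: \<kappa>_def)
    also have "\<dots> = \<epsilon> / 8 * real (card W)" using M by simp
    also have "\<dots> \<le> real (card P) * M" by (rule P(2))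
    finally have "M * (1280 * l ^ 10) \<le> M * real (card P)" by (simp add: mult_ac)
    then have P_big: "1280 * l ^ 10 \<le> real (card P)" using M by simp
    have l6: "l \<le> l ^ 10" "l ^ 6 \<le> l ^ 10" using l power_increasing[of 1 10 l] power_increasing[of 6 10 l] by auto
    have "200 * l \<le> real (card P)" using P_big l6 l by linarith
    from prune[OF finP this P(3)] obtain P' where P': "P' \<subseteq> P" "card P \<le> 2 * card P'"
      "\<And>u. u \<in> P' \<Longrightarrow> (\<Sum>w\<in>P'. 1 - A u w) \<le> real (card P') / 10" by blast
    have finP': "finite P'" using P'(1) finP finite_subset by blast
    have P'_big: "640 * l ^ 10 \<le> real (card P')" using P_big P'(2) by linarith
    have "100 * l \<le> real (card P')" using P'_big l6 l by linarith
    have "psd_on P' (shifted A l)" using psd_on_subset[OF psd _ fin] P'(1) P(1) by blast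
    from few_nonedges[OF finP' this l \<open>100 * l \<le> real (card P')\<close> P'(3)]
    have "(\<Sum>u\<in>P'. \<Sum>w\<in>P'. 1 - A u w) \<le> 4 * l ^ 3 * real (card P')" by simp
    from clique_of_sparse_complement[OF finP' _ this] l obtain C
      where C: "C \<subseteq> P'" "is_clique C" "real (card P') \<le> 4 * (4 * l ^ 3) * real (card C)" by auto
    have "l ^ 3 * (640 * l ^ 3) = 640 * l ^ 6" by (simp flip: power_add)
    also have "\<dots> \<le> l ^ 3 * (16 * real (card C))" using C(3) P'_big l6 by (simp add: mult_ac)
    finally have "40 * l ^ 3 \<le> real (card C)" using l by (simp del: power_eq_0_iff)
    then show ?thesis using C P'(1) P(1) by blast
  qed
  then show ?thesis using \<kappa> by blast
qed

section \<open>Splitting off cliques\<close>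

definition on_set :: "'a set \<Rightarrow> real \<Rightarrow> 'a \<Rightarrow> real" where
  "on_set S a = (\<lambda>i. if i \<in> S then a else 0)"

lemma bil_on_set:
  assumes "finite W" "S \<subseteq> W" "T \<subseteq> W"
  shows "bil W M (on_set S a) (on_set T b) = a * b * (\<Sum>u\<in>S. \<Sum>w\<in>T. M u w)"
proof -
  have "(\<Sum>j\<in>W. on_set S a i * M i j * on_set T b j) = (\<Sum>j\<in>T. on_set S a i * M i j * b)" for i
    using assms by (intro sum.mono_neutral_cong_right) (auto simp: on_set_def)
  then have "bil W M (on_set S a) (on_set T b) = (\<Sum>i\<in>W. \<Sum>j\<in>T. on_set S a i * M i j * b)"
    by (simp add: bil_def)
  also have "\<dots> = (\<Sum>i\<in>S. \<Sum>j\<in>T. a * M i j * b)"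
    using assms by (intro sum.mono_neutral_cong_right) (auto simp: on_set_def finite_subset)
  finally show ?thesis by (simp add: sum_distrib_left mult_ac)
qed

section \<open>Vertices against a large clique\<close>

context zero_one_matrix
begin

definition nbr :: "'a \<Rightarrow> 'a set \<Rightarrow> real" where
  "nbr u S = (\<Sum>w\<in>S. A u w)"

lemma sum_shifted: "finite S \<Longrightarrow> (\<Sum>w\<in>S. shifted A l u w) = nbr u S + (if u \<in> S then l else 0)"
  by (simp add: nbr_def shifted_def sum.distrib)

lemma nbr_le_card: "finite S \<Longrightarrow> nbr u S \<le> real (card S)"
proof -
  have "nbr u S \<le> (\<Sum>w\<in>S. 1)" unfolding nbr_def using nonadj_nonneg[of u] by (intro sum_mono) simp
  then show ?thesis by simp
qed

lemma nbr_clique: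
  assumes "finite C" "is_clique C" "u \<in> C"
  shows "nbr u C = real (card C) - 1"
proof -
  have "nbr u C = A u u + nbr u (C - {u})" unfolding nbr_def using assms by (simp add: sum.remove)
  also have "nbr u (C - {u}) = (\<Sum>w\<in>C - {u}. 1)"
    unfolding nbr_def using assms by (intro sum.cong refl) (auto simp: is_clique_def)
  also have "\<dots> = real (card C) - 1"
    using assms by (simp add: card_gt_0_iff Suc_leI of_nat_diff) (metis One_nat_def Suc_leI card_gt_0_iff empty_iff of_nat_1 of_nat_diff)
  finally show ?thesis by (simp add: A_diag)
qed

text \<open>In the semi-inner product of the shifted matrix the averages over the neighbours and over the
  non-neighbours of \<open>u\<close> in a clique nearly coincide, but \<open>u\<close> has inner product 1 with their
  difference.\<close>

lemma clique_dichotomy: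
  assumes fin: "finite W" and psd: "psd_on W (shifted A l)" and l: "1 \<le> l"
    and C: "C \<subseteq> W" "is_clique C" and u: "u \<in> W" "u \<notin> C"
  shows "nbr u C \<le> 2 * l\<^sup>2 \<or> real (card C) - nbr u C \<le> 2 * l\<^sup>2"
proof (rule ccontr)
  assume neg: "\<not> ?thesis"
  have finC: "finite C" using C fin finite_subset by blast
  define C1 where "C1 = {w \<in> C. A u w = 1}"
  define C2 where "C2 = C - C1"
  define k1 where "k1 = real (card C1)"
  define k2 where "k2 = real (card C2)"
  have sub: "C1 \<subseteq> W" "C2 \<subseteq> W" "finite C1" "finite C2" using C finC by (auto simp: C1_def C2_def)
  have nk: "nbr u C = k1" unfolding nbr_def k1_def C1_def
    by (rule sum_eq_card_support[OF finC A01])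
  have "real (card C) = k1 + k2" unfolding k1_def k2_def C2_def
    by (rule card_split[OF finC]) (auto simp: C1_def)
  then have k: "k1 > 2 * l\<^sup>2" "k2 > 2 * l\<^sup>2" using neg nk by auto
  have l2: "l\<^sup>2 \<ge> 1" using l by simp
  have kpos: "k1 > 0" "k2 > 0" using k l2 by linarith+
  have clq: "is_clique C1" "is_clique C2" using C(2) by (auto simp: is_clique_def C1_def C2_def)
  have self: "(\<Sum>v\<in>S. \<Sum>w\<in>S. shifted A l v w) = real (card S) * (real (card S) - 1 + l)"
    if "finite S" "is_clique S" for S
    using that by (simp add: sum_shifted nbr_clique)
  have cross: "(\<Sum>v\<in>C1. \<Sum>w\<in>C2. shifted A l v w) = k1 * k2"
  proof -
    have "(\<Sum>v\<in>C1. \<Sum>w\<in>C2. shifted A l v w) = (\<Sum>v\<in>C1. \<Sum>w\<in>C2. 1)"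
      using C(2) by (intro sum.cong refl) (auto simp: is_clique_def C1_def C2_def shifted_def)
    then show ?thesis by (simp add: k1_def k2_def)
  qed
  let ?B = "shifted A l"
  let ?a1 = "on_set C1 (1 / k1)" and ?a2 = "on_set C2 (1 / k2)" and ?e = "on_set {u} 1"
  have sym: "symmetric_on W ?B" using psd by (simp add: psd_on_def)
  \<comment> \<open>All inner products between the two parts of the clique are 1, so the ones in the
    square of \<open>z\<close> cancel and only the small diagonal contributions remain.\<close>
  define z where "z = (\<lambda>i. ?a1 i + (- 1) * ?a2 i)"
  have b11: "bil W ?B ?a1 ?a1 = 1 + (l - 1) / k1"
    using kpos by (simp add: bil_on_set[OF fin] sub self[OF sub(3) clq(1)] k1_def[symmetric] field_simps)
  have b22: "bil W ?B ?a2 ?a2 = 1 + (l - 1) / k2"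
    using kpos by (simp add: bil_on_set[OF fin] sub self[OF sub(4) clq(2)] k2_def[symmetric] field_simps)
  have b12: "bil W ?B ?a1 ?a2 = 1" using kpos by (simp add: bil_on_set[OF fin] sub cross)
  have zz: "bil W ?B z z = (l - 1) * (1 / k1 + 1 / k2)"
    unfolding z_def bil_lincomb[OF sym] b11 b22 b12 by (simp add: field_simps)
  have "(\<Sum>w\<in>C1. ?B u w) = k1"
    using u(2) sub by (simp add: sum_shifted nbr_def C1_def k1_def)
  moreover have "(\<Sum>w\<in>C2. ?B u w) = 0"
  proof -
    have "nbr u C2 = 0" unfolding nbr_def using A01[of u] by (intro sum.neutral) (auto simp: C1_def C2_def)
    then show ?thesis using u(2) sub by (simp add: sum_shifted C2_def)
  qed
  ultimately have "bil W ?B ?e z = 1"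
    unfolding z_def bil_add_right bil_scale_right using u(1) kpos by (simp add: bil_on_set[OF fin] sub)
  moreover have "bil W ?B ?e ?e = l" using u(1) by (simp add: bil_on_set[OF fin] shifted_def A_diag)
  ultimately have "1 \<le> l * ((l - 1) * (1 / k1 + 1 / k2))"
    using bil_Cauchy_Schwarz[OF psd, of ?e z] by (simp add: zz)
  also have "\<dots> \<le> l * ((l - 1) * (1 / (2 * l\<^sup>2) + 1 / (2 * l\<^sup>2)))"
    using k l l2 kpos by (intro mult_left_mono add_mono divide_left_mono mult_pos_pos) auto
  also have "\<dots> = (l - 1) / l" using l by (simp add: field_simps power2_eq_square)
  also have "\<dots> < 1" using l by simp
  finally show False by simp
qed

text \<open>The threshold is the second alternative of \<open>clique_dichotomy\<close>, so a vertex
  left outside has at most \<open>2 * l\<^sup>2\<close> neighbours in \<open>C\<close>.\<close>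

definition fat_clique :: "'a set \<Rightarrow> real \<Rightarrow> 'a set \<Rightarrow> 'a set" where
  "fat_clique W l C = {u \<in> W. real (card C) - 2 * l\<^sup>2 \<le> nbr u C}"

section \<open>The fat clique is almost complete and almost isolated\<close>

context
  fixes W C :: "'a set" and l :: real
  assumes fin: "finite W" and psd: "psd_on W (shifted A l)" and l: "1 \<le> l"
    and CW: "C \<subseteq> W" and clq: "is_clique C" and big: "40 * l ^ 3 \<le> real (card C)"
begin

private abbreviation (input) "s \<equiv> real (card C)"
private abbreviation (input) "B \<equiv> shifted A l"
private abbreviation (input) "a \<equiv> on_set C (1 / s)"
private abbreviation (input) "C' \<equiv> fat_clique W l C"

lemma finC: "finite C" using CW fin finite_subset by blast

lemma l_powers: "1 \<le> l\<^sup>2" "l \<le> l\<^sup>2" "l\<^sup>2 \<le> l ^ 3"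
  using l power_increasing[of 1 2 l] power_increasing[of 2 3 l] by auto

lemma s_bounds: "40 * l\<^sup>2 \<le> s" "0 < s" "2 * l\<^sup>2 / s \<le> 1 / 2"
proof -
  show 1: "40 * l\<^sup>2 \<le> s" using l_powers big by linarith
  then show "0 < s" using l_powers by linarith
  with 1 show "2 * l\<^sup>2 / s \<le> 1 / 2" using l_powers by (simp add: field_simps)
qed

lemma fat_subset: "C' \<subseteq> W" "finite C'"
  using fin by (auto simp: fat_clique_def)

lemma clique_subset_fat: "C \<subseteq> C'"
  using nbr_clique[OF finC clq] CW l_powers by (auto simp: fat_clique_def)

lemma card_fat: "s \<le> real (card C')"
  using card_mono[OF fat_subset(2) clique_subset_fat] by simp

lemma sum_into_clique: "w \<in> C' \<Longrightarrow> s - 2 * l\<^sup>2 \<le> (\<Sum>v\<in>C. B w v)"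
  unfolding sum_shifted[OF finC] using l by (auto simp: fat_clique_def)

lemma bil_aa: "bil W B a a \<le> 1 + l / s"
proof -
  have "(\<Sum>u\<in>C. \<Sum>w\<in>C. B u w) = s * (s - 1 + l)"
    by (simp add: sum_shifted[OF finC] nbr_clique[OF finC clq])
  then have "bil W B a a = 1 + (l - 1) / s"
    using s_bounds by (simp add: bil_on_set[OF fin CW CW] field_simps)
  also have "\<dots> \<le> 1 + l / s" using s_bounds by (simp add: divide_right_mono)
  finally show ?thesis .
qed

text \<open>Members of the fat clique miss at most \<open>2 * l\<^sup>2\<close> vertices of
  \<open>C\<close>. Used for the whole fat clique with weight 1 and for a set of neighbours with the
  averaging weight.\<close>

lemma bil_avg_ge:
  assumes "S \<subseteq> C'" "0 \<le> c"
  shows "c * real (card S) * (1 - 2 * l\<^sup>2 / s) \<le> bil W B (on_set S c) a"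
proof -
  have SW: "S \<subseteq> W" using assms fat_subset by blast
  have "c * real (card S) * (1 - 2 * l\<^sup>2 / s) = c * (1 / s) * (\<Sum>w\<in>S. s - 2 * l\<^sup>2)"
    using s_bounds by (simp add: field_simps)
  also have "\<dots> \<le> c * (1 / s) * (\<Sum>w\<in>S. \<Sum>v\<in>C. B w v)"
    using assms s_bounds by (intro mult_left_mono sum_mono sum_into_clique) auto
  also have "\<dots> = bil W B (on_set S c) a" by (simp add: bil_on_set[OF fin SW CW])
  finally show ?thesis .
qed

text \<open>With \<open>m\<close> the size of the fat clique, its indicator minus \<open>m\<close>
  times \<open>a\<close> has nonnegative square. As \<open>a\<close> has square about 1 and inner
  product about \<open>m\<close> with the indicator, the indicator has square about
  \<open>m\<^sup>2\<close>, that is, nearly all pairs are edges.\<close>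

lemma fat_clique_dense:
  "(\<Sum>u\<in>C'. \<Sum>w\<in>C'. 1 - A u w) \<le> 6 * l\<^sup>2 / s * (real (card C'))\<^sup>2"
proof -
  define m where "m = real (card C')"
  have m: "s \<le> m" "0 < m" using card_fat s_bounds by (auto simp: m_def)
  have sym: "symmetric_on W B" using psd by (simp add: psd_on_def)
  define S where "S = (\<Sum>u\<in>C'. \<Sum>w\<in>C'. A u w)"
  have xx: "bil W B (on_set C' 1) (on_set C' 1) = S + l * m"
    using fat_subset by (simp add: bil_on_set[OF fin] sum_shifted nbr_def sum.distrib S_def m_def)
  have xa: "m * (1 - 2 * l\<^sup>2 / s) \<le> bil W B (on_set C' 1) a"
    using bil_avg_ge[of C' 1] by (simp add: m_def)
  have "0 \<le> bil W B (on_set C' 1) (on_set C' 1) + 2 * (- m) * bil W B (on_set C' 1) a + (- m)\<^sup>2 * bil W B a a"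
    unfolding bil_lincomb[OF sym, symmetric] by (rule bil_nonneg[OF psd])
  also have "\<dots> \<le> (S + l * m) + 2 * (- m) * (m * (1 - 2 * l\<^sup>2 / s)) + m\<^sup>2 * (1 + l / s)"
    using xa bil_aa m by (intro add_mono mult_left_mono mult_left_mono_neg) (auto simp: xx)
  also have "\<dots> = S - m\<^sup>2 + l * m + m\<^sup>2 * (4 * l\<^sup>2 / s) + m\<^sup>2 * (l / s)"
    by (simp add: power2_eq_square algebra_simps)
  also have "l * m \<le> m\<^sup>2 * (l / s)"
  proof -
    have "l * m * 1 \<le> l * m * (m / s)" using m l s_bounds by (intro mult_left_mono) auto
    then show ?thesis by (simp add: power2_eq_square mult_ac)
  qed
  finally have "m\<^sup>2 - S \<le> m\<^sup>2 * (l / s) + m\<^sup>2 * (4 * l\<^sup>2 / s) + m\<^sup>2 * (l / s)" by simp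
  also have "m\<^sup>2 * (l / s) \<le> m\<^sup>2 * (l\<^sup>2 / s)"
    using l_powers s_bounds by (intro mult_left_mono divide_right_mono) auto
  finally have "m\<^sup>2 - S \<le> 6 * l\<^sup>2 / s * m\<^sup>2"
    using \<open>m\<^sup>2 * (l / s) \<le> m\<^sup>2 * (l\<^sup>2 / s)\<close> by (simp add: mult_ac)
  then show ?thesis by (simp add: S_def m_def sum_subtractf power2_eq_square)
qed

text \<open>The average over the neighbours \<open>S\<close> of \<open>u\<close> in the fat clique
  nearly coincides with \<open>a\<close> once \<open>S\<close> is large, but \<open>u\<close> has
  inner product 1 with the first and at most 1/2 with the second. The thresholds
  \<open>8 * l\<^sup>2\<close> and \<open>40 * l ^ 3\<close> make the two error terms 1/8 each,
  against the square of 1/2.\<close>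

lemma few_edges_into_fat_clique:
  assumes u: "u \<in> W" "u \<notin> C'"
  shows "nbr u C' \<le> 8 * l\<^sup>2"
proof (rule ccontr)
  assume neg: "\<not> ?thesis"
  have uC: "u \<notin> C" using u clique_subset_fat by blast
  have "nbr u C \<le> 2 * l\<^sup>2"
    using clique_dichotomy[OF fin psd l CW clq u(1) uC] u by (auto simp: fat_clique_def)
  then have "(\<Sum>v\<in>C. B u v) \<le> 2 * l\<^sup>2" using uC by (simp add: sum_shifted[OF finC])
  then have "(\<Sum>v\<in>C. B u v) / s \<le> 2 * l\<^sup>2 / s" using s_bounds by (intro divide_right_mono) auto
  moreover have "bil W B (on_set {u} 1) a = (\<Sum>v\<in>C. B u v) / s"
    using u(1) CW by (simp add: bil_on_set[OF fin])
  ultimately have ua: "bil W B (on_set {u} 1) a \<le> 1 / 2" using s_bounds(3) by linarith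
  define S where "S = {w \<in> C'. A u w = 1}"
  define k where "k = real (card S)"
  have S: "S \<subseteq> C'" "S \<subseteq> W" "finite S" using fat_subset by (auto simp: S_def)
  have "nbr u C' = k" unfolding nbr_def k_def S_def by (rule sum_eq_card_support[OF fat_subset(2) A01])
  then have k: "8 * l\<^sup>2 < k" using neg by simp
  then have k0: "0 < k" using l_powers by linarith
  let ?b = "on_set S (1 / k)" and ?e = "on_set {u} 1"
  have sym: "symmetric_on W B" using psd by (simp add: psd_on_def)
  define z where "z = (\<lambda>i. ?b i + (- 1) * a i)"
  have uS: "u \<notin> S" using u S by blast
  have "nbr u S = k" by (simp add: nbr_def S_def k_def)
  then have "(\<Sum>w\<in>S. B u w) = k" using uS S by (simp add: sum_shifted)
  then have "bil W B ?e ?b = 1" using S u k0 by (simp add: bil_on_set[OF fin])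
  then have ez: "1 / 2 \<le> bil W B ?e z"
    unfolding z_def bil_add_right bil_scale_right using ua by simp
  have "(\<Sum>v\<in>S. \<Sum>w\<in>S. B v w) \<le> (\<Sum>v\<in>S. k + l)"
    using nbr_le_card[OF S(3)] by (intro sum_mono) (simp add: sum_shifted[OF S(3)] k_def)
  then have "bil W B ?b ?b \<le> (1 / k) * (1 / k) * (k * (k + l))"
    unfolding bil_on_set[OF fin S(2) S(2)] by (intro mult_left_mono) (auto simp: k_def)
  also have "\<dots> = 1 + l / k" using k0 by (simp add: field_simps)
  finally have bb: "bil W B ?b ?b \<le> 1 + l / k" .
  have ba: "1 - 2 * l\<^sup>2 / s \<le> bil W B ?b a"
    using bil_avg_ge[OF S(1), of "1 / k"] k0 by (simp add: k_def[symmetric])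
  have "bil W B z z = bil W B ?b ?b - 2 * bil W B ?b a + bil W B a a"
    unfolding z_def bil_lincomb[OF sym] by simp
  also have "\<dots> \<le> l / k + (l / s + 4 * l\<^sup>2 / s)" using bb ba bil_aa by linarith
  also have "\<dots> \<le> l / k + 5 * l\<^sup>2 / s"
    using l_powers s_bounds by (simp add: add_divide_distrib[symmetric] divide_right_mono)
  finally have zz: "bil W B z z \<le> l / k + 5 * l\<^sup>2 / s" .
  have ee: "bil W B ?e ?e = l" using u(1) by (simp add: bil_on_set[OF fin] shifted_def A_diag)
  have "(1 / 2)\<^sup>2 \<le> (bil W B ?e z)\<^sup>2" using ez by (intro power_mono) auto
  also have "\<dots> \<le> l * bil W B z z" using bil_Cauchy_Schwarz[OF psd, of ?e z] by (simp add: ee)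
  also have "\<dots> \<le> l * (l / k + 5 * l\<^sup>2 / s)" using zz l by (intro mult_left_mono) auto
  also have "\<dots> = l\<^sup>2 / k + 5 * l ^ 3 / s" by (simp add: algebra_simps power2_eq_square power3_eq_cube)
  also have "\<dots> < 1 / 8 + 1 / 8"
  proof (rule add_less_le_mono)
    show "l\<^sup>2 / k < 1 / 8" using k k0 by (simp add: field_simps)
    show "5 * l ^ 3 / s \<le> 1 / 8" using big s_bounds by (simp add: field_simps)
  qed
  finally show False by (simp add: power2_eq_square)
qed

end

section \<open>Clusterings and their cost\<close>

definition err :: "('a \<Rightarrow> 'a) \<Rightarrow> 'a \<Rightarrow> 'a \<Rightarrow> real" where
  "err f u w = (if u = w then 0 else if f u = f w then 1 - A u w else A u w)"

text \<open>Clusters are the fibres of the labelling \<open>f\<close>. Ordered pairs are counted, so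
  every wrong pair contributes twice.\<close>

definition cost :: "('a \<Rightarrow> 'a) \<Rightarrow> 'a set \<Rightarrow> real" where
  "cost f W = (\<Sum>u\<in>W. \<Sum>w\<in>W. err f u w)"

lemma err_sym: "err f u w = err f w u"
  by (simp add: err_def A_sym[of u w])

lemma cost_split:
  assumes "finite W" "S \<subseteq> W"
  shows "cost f W = cost f S + cost f (W - S) + 2 * (\<Sum>u\<in>W - S. \<Sum>w\<in>S. err f u w)"
proof -
  have sp: "sum g W = sum g S + sum g (W - S)" for g :: "'a \<Rightarrow> real"
    using sum.subset_diff[OF assms(2,1), of g] by simp
  have "cost f W = cost f S + (\<Sum>u\<in>S. \<Sum>w\<in>W - S. err f u w)
      + ((\<Sum>u\<in>W - S. \<Sum>w\<in>S. err f u w) + cost f (W - S))"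
  proof -
    have "cost f W = (\<Sum>u\<in>W. (\<Sum>w\<in>S. err f u w) + (\<Sum>w\<in>W - S. err f u w))"
      unfolding cost_def by (intro sum.cong refl sp)
    also have "\<dots> = (\<Sum>u\<in>S. (\<Sum>w\<in>S. err f u w) + (\<Sum>w\<in>W - S. err f u w))
        + (\<Sum>u\<in>W - S. (\<Sum>w\<in>S. err f u w) + (\<Sum>w\<in>W - S. err f u w))" by (rule sp)
    finally show ?thesis by (simp add: sum.distrib cost_def)
  qed
  also have "(\<Sum>u\<in>S. \<Sum>w\<in>W - S. err f u w) = (\<Sum>u\<in>W - S. \<Sum>w\<in>S. err f u w)"
    by (subst sum.swap) (simp add: err_sym)
  finally show ?thesis by simp
qed

text \<open>Fat cliques are split off as one cluster each until fewer than
  \<open>\<eta> * n\<^sup>2\<close> ordered edges remain, and the remaining vertices become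
  singletons. Splitting off \<open>m\<close> vertices costs at most \<open>m * n / l\<close>, which
  is charged to these vertices.\<close>

lemma cluster_labelling:
  assumes fin: "finite U" and psd: "psd_on U (shifted A l)" and l: "1 \<le> l" and n: "real (card U) \<le> n"
    and cl: "\<And>W. W \<subseteq> U \<Longrightarrow> \<eta> * n\<^sup>2 \<le> (\<Sum>u\<in>W. \<Sum>w\<in>W. A u w) \<Longrightarrow>
      \<exists>C\<subseteq>W. is_clique C \<and> 40 * l ^ 3 \<le> real (card C)"
  shows "W \<subseteq> U \<Longrightarrow> \<exists>f. f ` W \<subseteq> W \<and> cost f W \<le> real (card W) * n / l + \<eta> * n\<^sup>2"
proof (induction "card W" arbitrary: W rule: less_induct)
  case less
  have finW: "finite W" using less.prems fin finite_subset by blast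
  have n0: "0 \<le> n" using n by linarith
  show ?case
  proof (cases "\<eta> * n\<^sup>2 \<le> (\<Sum>u\<in>W. \<Sum>w\<in>W. A u w)")
    case False
    have "cost (\<lambda>u. u) W = (\<Sum>u\<in>W. \<Sum>w\<in>W. A u w)"
      unfolding cost_def by (intro sum.cong refl) (simp add: err_def A_diag)
    also have "\<dots> \<le> real (card W) * n / l + \<eta> * n\<^sup>2"
    proof -
      have "0 \<le> real (card W) * n / l" using n0 l by simp
      then show ?thesis using False by linarith
    qed
    finally show ?thesis by (intro exI[of _ "\<lambda>u. u"]) auto
  next
    case True
    then obtain C where C: "C \<subseteq> W" "is_clique C" "40 * l ^ 3 \<le> real (card C)"
      using cl[OF less.prems] by blast
    have psdW: "psd_on W (shifted A l)" by (rule psd_on_subset[OF psd less.prems fin])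
    note ctx = finW psdW l C
    define D where "D = fat_clique W l C"
    define s where "s = real (card C)"
    define m where "m = real (card D)"
    have DW: "D \<subseteq> W" "finite D" unfolding D_def using fat_subset[OF ctx] by auto
    have s0: "0 < s" unfolding s_def by (rule s_bounds(2)[OF ctx])
    have sm: "s \<le> m" unfolding s_def m_def D_def by (rule card_fat[OF ctx])
    obtain c where c: "c \<in> D" using sm s0 by (cases "D = {}") (auto simp: m_def)
    have smaller: "card (W - D) < card W" using DW c finW by (intro psubset_card_mono) auto
    have "W - D \<subseteq> U" using less.prems by blast
    from less.hyps[OF smaller this] obtain g where g: "g ` (W - D) \<subseteq> W - D"
      "cost g (W - D) \<le> real (card (W - D)) * n / l + \<eta> * n\<^sup>2" by blast
    define f where "f u = (if u \<in> D then c else g u)" for u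
    have fim: "f ` W \<subseteq> W" using g(1) c DW by (auto simp: f_def)
    have 1: "cost f D \<le> 6 * l\<^sup>2 / s * m\<^sup>2"
    proof -
      have "cost f D \<le> (\<Sum>u\<in>D. \<Sum>w\<in>D. 1 - A u w)"
        unfolding cost_def by (intro sum_mono) (auto simp: err_def f_def nonadj_nonneg A_diag)
      also have "\<dots> \<le> 6 * l\<^sup>2 / s * m\<^sup>2" unfolding D_def s_def m_def by (rule fat_clique_dense[OF ctx])
      finally show ?thesis .
    qed
    have 2: "cost f (W - D) = cost g (W - D)"
      unfolding cost_def by (intro sum.cong refl) (auto simp: err_def f_def)
    have 3: "(\<Sum>u\<in>W - D. \<Sum>w\<in>D. err f u w) \<le> n * (8 * l\<^sup>2)"
    proof -
      have "(\<Sum>u\<in>W - D. \<Sum>w\<in>D. err f u w) = (\<Sum>u\<in>W - D. nbr u D)"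
        unfolding nbr_def
      proof (intro sum.cong refl)
        fix u w assume u: "u \<in> W - D" and w: "w \<in> D"
        have "f u \<noteq> f w" using u w g(1) c by (auto simp: f_def)
        then show "err f u w = A u w" using u w by (auto simp: err_def)
      qed
      also have "\<dots> \<le> (\<Sum>u\<in>W - D. 8 * l\<^sup>2)"
        unfolding D_def by (intro sum_mono few_edges_into_fat_clique[OF ctx]) auto
      also have "\<dots> = real (card (W - D)) * (8 * l\<^sup>2)" by simp
      also have "\<dots> \<le> n * (8 * l\<^sup>2)"
      proof (rule mult_right_mono)
        have "card (W - D) \<le> card U" using \<open>W - D \<subseteq> U\<close> fin by (rule card_mono[rotated])
        then show "real (card (W - D)) \<le> n" using n by linarith
      qed simp
      finally show ?thesis .
    qed
    have mn: "m \<le> n"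
    proof -
      have "card D \<le> card U" using DW(1) less.prems fin by (intro card_mono) auto
      then show ?thesis using n by (simp add: m_def)
    qed
    have m0: "0 \<le> m" by (simp add: m_def)
    \<comment> \<open>The coefficient collects 6 from non-edges inside \<open>D\<close> and 2 * 8
      from edges leaving it; a clique of size \<open>40 * l ^ 3\<close> pays for both.\<close>
    have coef: "22 * l\<^sup>2 / s \<le> 1 / l"
    proof -
      have "22 * l\<^sup>2 * l \<le> 40 * l ^ 3" using l by (simp add: power2_eq_square power3_eq_cube)
      also have "\<dots> \<le> s" using C(3) by (simp add: s_def)
      finally show ?thesis using s0 l by (simp add: field_simps)
    qed
    have "6 * l\<^sup>2 / s * m\<^sup>2 + 2 * (n * (8 * l\<^sup>2)) \<le> 22 * l\<^sup>2 / s * (m * n)"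
    proof -
      have "6 * l\<^sup>2 / s * m\<^sup>2 \<le> 6 * l\<^sup>2 / s * (m * n)"
        unfolding power2_eq_square[of m] using mn m0 s0 by (intro mult_left_mono) auto
      moreover have "16 * l\<^sup>2 * n * 1 \<le> 16 * l\<^sup>2 * n * (m / s)" using sm s0 n0 by (intro mult_left_mono) auto
      moreover have "16 * l\<^sup>2 * n * (m / s) = 16 * l\<^sup>2 / s * (m * n)" by simp
      moreover have "2 * (n * (8 * l\<^sup>2)) = 16 * l\<^sup>2 * n * 1" by simp
      moreover have "6 * l\<^sup>2 / s * (m * n) + 16 * l\<^sup>2 / s * (m * n) = 22 * l\<^sup>2 / s * (m * n)"
        by (simp add: field_simps)
      ultimately show ?thesis by linarith
    qed
    also have "\<dots> \<le> 1 / l * (m * n)" using coef m0 n0 by (intro mult_right_mono) auto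
    finally have 4: "6 * l\<^sup>2 / s * m\<^sup>2 + 2 * (n * (8 * l\<^sup>2)) \<le> m * n / l" by simp
    have cardW: "real (card W) = m + real (card (W - D))"
      unfolding m_def by (rule card_split[OF finW DW(1)])
    have "cost f W \<le> m * n / l + (real (card (W - D)) * n / l + \<eta> * n\<^sup>2)"
      unfolding cost_split[OF finW DW(1), of f] 2 using 1 3 4 g(2) by linarith
    also have "\<dots> = real (card W) * n / l + \<eta> * n\<^sup>2"
      unfolding cardW by (simp add: add_divide_distrib algebra_simps)
    finally show ?thesis using fim by blast
  qed
qed

end

section \<open>Semidefinite duality\<close>

lemma psd_on_entry_le_1:
  assumes "finite V" "psd_on V M" "\<And>i. i \<in> V \<Longrightarrow> M i i \<le> 1" "i \<in> V" "j \<in> V"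
  shows "\<bar>M i j\<bar> \<le> 1"
proof -
  have "(M i j)\<^sup>2 \<le> 1 * 1"
    by (rule order_trans[OF psd_on_entry_sq[OF assms(1,2,4,5)]], rule mult_mono)
      (use assms psd_on_diag_nonneg[OF assms(1,2)] in auto)
  then show ?thesis by (simp add: abs_square_le_1)
qed

lemma abs_mat_inner_le:
  assumes "\<And>i j. i \<in> V \<Longrightarrow> j \<in> V \<Longrightarrow> \<bar>M i j\<bar> \<le> 1"
  shows "\<bar>mat_inner V A M\<bar> \<le> (\<Sum>i\<in>V. \<Sum>j\<in>V. \<bar>A i j\<bar>)"
  unfolding mat_inner_def
proof (rule order_trans[OF sum_abs] sum_mono)+
  fix i j assume "i \<in> V" "j \<in> V"
  then have "\<bar>A i j\<bar> * \<bar>M i j\<bar> \<le> \<bar>A i j\<bar> * 1" by (intro mult_left_mono assms) auto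
  then show "\<bar>A i j * M i j\<bar> \<le> \<bar>A i j\<bar>" by (simp add: abs_mult)
qed

lemma mat_inner_lincomb:
  "mat_inner V A (\<lambda>i j. a * M i j + b * M' i j) = a * mat_inner V A M + b * mat_inner V A M'"
  by (simp add: mat_inner_def sum.distrib sum_distrib_left algebra_simps)

lemma mat_inner_scale: "mat_inner V A (\<lambda>i j. a * M i j) = a * mat_inner V A M"
  by (simp add: mat_inner_def sum_distrib_left algebra_simps)

lemma bil_scale_mat: "bil W (\<lambda>i j. c * M i j) x y = c * bil W M x y"
  by (simp add: bil_def sum_distrib_left mult_ac)

lemma psd_on_scale: "psd_on V M \<Longrightarrow> 0 \<le> c \<Longrightarrow> psd_on V (\<lambda>i j. c * M i j)"
  by (auto simp: psd_on_iff_bil symmetric_on_def bil_scale_mat)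

text \<open>A second-order upper expansion of the squared positive part, whose derivative at
  \<open>a\<close> is \<open>2 * max 0 a\<close>.\<close>

lemma max_zero_sq_add: "(max 0 (a + b))\<^sup>2 \<le> (max 0 a)\<^sup>2 + 2 * max 0 a * b + b\<^sup>2" for a b :: real
proof (cases "a \<ge> 0")
  case True
  have "(max 0 (a + b))\<^sup>2 \<le> (a + b)\<^sup>2" by (cases "a + b \<ge> 0") (auto simp: max_def)
  then show ?thesis using True by (simp add: power2_sum)
next
  case False
  have "(max 0 (a + b))\<^sup>2 \<le> b\<^sup>2"
  proof (cases "a + b \<ge> 0")
    case True
    then show ?thesis using False by (simp add: max_def power_mono)
  qed (simp add: max_def)
  then show ?thesis using False by (simp add: max_def)
qed

text \<open>The weights are the positive parts of the slacks \<open>\<tau> M\<^sub>i\<^sub>i + \<langle>A, M\<rangle>\<close> at a nearly optimal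
  trace-one matrix \<open>M\<close>, so that no compactness is needed.\<close>

theorem sdp_duality:
  fixes A :: "'a \<Rightarrow> 'a \<Rightarrow> real"
  assumes fin: "finite V" and ne: "V \<noteq> {}" and sym: "symmetric_on V A" and \<tau>: "0 \<le> \<tau>" "\<tau>\<^sub>0 < \<tau>"
    and primal: "\<And>M. psd_on V M \<Longrightarrow> (\<And>i. i \<in> V \<Longrightarrow> M i i \<le> 1) \<Longrightarrow> - mat_inner V A M \<le> \<tau>\<^sub>0"
  shows "\<exists>d. (\<forall>i\<in>V. 0 \<le> d i) \<and> sum d V = \<tau> \<and> psd_on V (\<lambda>u w. A u w + (if u = w then d u else 0))"
proof -
  define n where "n = real (card V)"
  have n0: "n > 0" using fin ne by (simp add: n_def card_gt_0_iff)
  define S where "S = {M. psd_on V M \<and> (\<Sum>i\<in>V. M i i) = 1}"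
  define y where "y M i = \<tau> * M i i + mat_inner V A M" for M i
  \<comment> \<open>A penalty on the positive slacks over trace-one matrices; half of its gradient
    with respect to the slacks is the weight vector \<open>w\<close> below.\<close>
  define \<Phi> where "\<Phi> M = (\<Sum>i\<in>V. (max 0 (y M i))\<^sup>2)" for M
  define \<eta> where "\<eta> = (\<tau> - \<tau>\<^sub>0) / n"
  have \<eta>: "\<eta> > 0" using \<tau> n0 by (simp add: \<eta>_def)
  have \<Phi>_ge: "\<eta>\<^sup>2 \<le> \<Phi> M" if M: "M \<in> S" for M
  proof -
    have psd: "psd_on V M" and tr: "(\<Sum>i\<in>V. M i i) = 1" using M by (auto simp: S_def)
    \<comment> \<open>Dividing by the largest diagonal entry makes \<open>M\<close> feasible for the
      primal bound; trace 1 keeps this entry at least \<open>1 / n\<close>.\<close>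
    define t where "t = Max ((\<lambda>i. M i i) ` V)"
    have t_ge: "M i i \<le> t" if "i \<in> V" for i unfolding t_def using fin that by auto
    have "t \<in> (\<lambda>i. M i i) ` V" unfolding t_def using fin ne by (intro Max_in) auto
    then obtain i0 where i0: "i0 \<in> V" "M i0 i0 = t" by auto
    have "1 \<le> (\<Sum>i\<in>V. t)" unfolding tr[symmetric] by (intro sum_mono t_ge)
    then have nt: "1 \<le> n * t" by (simp add: n_def)
    then have t0: "t > 0" using n0 zero_less_mult_pos[of n t] by linarith
    have "- mat_inner V A (\<lambda>i j. (1 / t) * M i j) \<le> \<tau>\<^sub>0"
    proof (rule primal)
      show "psd_on V (\<lambda>i j. (1 / t) * M i j)" using t0 by (intro psd_on_scale psd) auto
      show "(1 / t) * M i i \<le> 1" if "i \<in> V" for i using t_ge[OF that] t0 by simp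
    qed
    then have "- mat_inner V A M \<le> \<tau>\<^sub>0 * t" unfolding mat_inner_scale using t0 by (simp add: field_simps)
    then have "(\<tau> - \<tau>\<^sub>0) * t \<le> y M i0" by (simp add: y_def i0 algebra_simps)
    moreover have "\<eta> \<le> (\<tau> - \<tau>\<^sub>0) * t"
    proof -
      have "(\<tau> - \<tau>\<^sub>0) * 1 \<le> (\<tau> - \<tau>\<^sub>0) * (n * t)" using \<tau> nt by (intro mult_left_mono) auto
      then show ?thesis using n0 by (simp add: \<eta>_def field_simps)
    qed
    ultimately have "\<eta> \<le> max 0 (y M i0)" by simp
    then have "\<eta>\<^sup>2 \<le> (max 0 (y M i0))\<^sup>2" using \<eta> by (intro power_mono) auto
    also have "\<dots> \<le> \<Phi> M" unfolding \<Phi>_def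
      using fin i0(1) by (intro member_le_sum[of i0 V "\<lambda>i. (max 0 (y M i))\<^sup>2"]) auto
    finally show ?thesis .
  qed
  define a where "a = (\<Sum>i\<in>V. \<Sum>j\<in>V. \<bar>A i j\<bar>)"
  define R where "R = 2 * (\<tau> + a)"
  have y_bd: "\<bar>y M i\<bar> \<le> \<tau> + a" if M: "M \<in> S" and i: "i \<in> V" for M i
  proof -
    have psd: "psd_on V M" and tr: "(\<Sum>i\<in>V. M i i) = 1" using M by (auto simp: S_def)
    have d0: "0 \<le> M j j" if "j \<in> V" for j using psd_on_diag_nonneg[OF fin psd that] .
    have d1: "M j j \<le> 1" if "j \<in> V" for j
      unfolding tr[symmetric] using fin that d0 by (intro member_le_sum) auto
    have "\<bar>mat_inner V A M\<bar> \<le> a"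
      unfolding a_def by (intro abs_mat_inner_le psd_on_entry_le_1[OF fin psd d1])
    moreover have "\<bar>\<tau> * M i i\<bar> \<le> \<tau> * 1"
      unfolding abs_mult using d0[OF i] d1[OF i] \<tau>(1) by (intro mult_mono) auto
    ultimately show ?thesis unfolding y_def by linarith
  qed
  define Q where "Q = n * R\<^sup>2"
  have Q0: "0 \<le> Q" using n0 by (simp add: Q_def)
  \<comment> \<open>A step length short enough that the second-order term
    \<open>\<theta> * Q\<close> stays below \<open>\<eta>\<^sup>2 / 2\<close>.\<close>
  define \<theta> where "\<theta> = min 1 (\<eta>\<^sup>2 / (2 * (Q + 1)))"
  have \<theta>: "0 < \<theta>" "\<theta> \<le> 1" using \<eta> Q0 by (auto simp: \<theta>_def)
  have \<theta>Q: "\<theta> * Q \<le> \<eta>\<^sup>2 / 2"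
  proof -
    have "\<theta> * Q \<le> \<eta>\<^sup>2 / (2 * (Q + 1)) * (Q + 1)"
      using Q0 \<eta> by (intro mult_mono) (auto simp: \<theta>_def)
    also have "\<dots> = \<eta>\<^sup>2 / 2" using Q0 by (simp add: field_simps)
    finally show ?thesis .
  qed
  \<comment> \<open>The tolerance for near optimality carries a factor \<open>\<theta>\<close>, so
    that after division by \<open>\<theta>\<close> it too costs only
    \<open>\<eta>\<^sup>2 / 2\<close>.\<close>
  define \<xi> where "\<xi> = \<theta> * (\<eta>\<^sup>2 / 2)"
  have \<xi>: "\<xi> > 0" using \<theta> \<eta> by (simp add: \<xi>_def)
  obtain v where v: "v \<in> V" using ne by blast
  have "(\<lambda>i j. (if i = v then 1 else 0) * (if j = v then 1 else 0)) \<in> S"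
  proof -
    have "psd_on V (\<lambda>i j. 1 * ((\<lambda>i. if i = v then 1 else 0) i * (\<lambda>i. if i = v then 1 else 0) j))"
      using psd_on_rank_one_sum[of "{0::nat}" "\<lambda>_. 1" V "\<lambda>_ i. if i = v then 1 else 0"] by simp
    then show ?thesis using fin v by (simp add: S_def if_distrib[where f="\<lambda>a. a * _"] cong: if_cong)
  qed
  then have Sne: "S \<noteq> {}" by blast
  define \<iota> where "\<iota> = Inf (\<Phi> ` S)"
  have bdd: "bdd_below (\<Phi> ` S)" by (rule bdd_belowI[of _ "\<eta>\<^sup>2"]) (auto simp: \<Phi>_ge)
  have "\<exists>M\<in>S. \<Phi> M < \<iota> + \<xi>"
    using cInf_lessD[of "\<Phi> ` S" "\<iota> + \<xi>"] Sne \<xi> by (auto simp: \<iota>_def)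
  then obtain Ms where Ms: "Ms \<in> S" "\<Phi> Ms < \<iota> + \<xi>" by blast
  define w where "w i = max 0 (y Ms i)" for i
  have w0: "0 \<le> w i" for i by (simp add: w_def)
  have wy: "(\<Sum>i\<in>V. w i * y Ms i) = \<Phi> Ms"
    unfolding \<Phi>_def w_def by (intro sum.cong refl) (simp add: max_def power2_eq_square)
  have main: "0 \<le> (\<Sum>i\<in>V. w i * y M i)" if M: "M \<in> S" for M
  proof -
    \<comment> \<open>A short step from the near-minimiser towards \<open>M\<close> cannot lower
      \<open>\<Phi>\<close> by more than \<open>\<xi>\<close>, which bounds the directional
      derivative \<open>2 * X\<close> from below.\<close>
    define N where "N = (\<lambda>i j. (1 - \<theta>) * Ms i j + \<theta> * M i j)"
    have "psd_on V N" unfolding N_def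
      using Ms(1) M \<theta> by (intro psd_on_add psd_on_scale) (auto simp: S_def)
    moreover have "(\<Sum>i\<in>V. N i i) = 1"
      using Ms(1) M by (simp add: N_def S_def sum.distrib sum_distrib_left[symmetric])
    ultimately have "N \<in> S" by (simp add: S_def)
    then have "\<iota> \<le> \<Phi> N" unfolding \<iota>_def by (intro cInf_lower bdd) auto
    define X where "X = (\<Sum>i\<in>V. w i * (y M i - y Ms i))"
    have yN: "y N i = y Ms i + \<theta> * (y M i - y Ms i)" for i
      unfolding y_def N_def mat_inner_lincomb by (simp add: algebra_simps)
    have "\<Phi> N \<le> (\<Sum>i\<in>V. (w i)\<^sup>2 + 2 * w i * (\<theta> * (y M i - y Ms i)) + (\<theta> * (y M i - y Ms i))\<^sup>2)"
      unfolding \<Phi>_def yN w_def by (intro sum_mono max_zero_sq_add)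
    also have "\<dots> = \<Phi> Ms + 2 * \<theta> * X + \<theta>\<^sup>2 * (\<Sum>i\<in>V. (y M i - y Ms i)\<^sup>2)"
      by (simp add: \<Phi>_def w_def X_def sum.distrib sum_distrib_left power_mult_distrib mult_ac)
    also have "\<dots> \<le> \<Phi> Ms + 2 * \<theta> * X + \<theta>\<^sup>2 * Q"
    proof -
      have "(\<Sum>i\<in>V. (y M i - y Ms i)\<^sup>2) \<le> (\<Sum>i\<in>V. R\<^sup>2)"
      proof (rule sum_mono)
        fix i assume i: "i \<in> V"
        have "\<bar>y M i - y Ms i\<bar> \<le> R" using y_bd[OF M i] y_bd[OF Ms(1) i] by (simp add: R_def abs_le_iff)
        then have "\<bar>y M i - y Ms i\<bar> \<le> \<bar>R\<bar>" by simp
        then show "(y M i - y Ms i)\<^sup>2 \<le> R\<^sup>2" by (simp add: abs_le_square_iff)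
      qed
      also have "\<dots> = Q" by (simp add: Q_def n_def)
      finally show ?thesis by (simp add: mult_left_mono)
    qed
    finally have "\<iota> \<le> \<Phi> Ms + 2 * \<theta> * X + \<theta>\<^sup>2 * Q" using \<open>\<iota> \<le> \<Phi> N\<close> by linarith
    then have "0 \<le> \<xi> + 2 * \<theta> * X + \<theta>\<^sup>2 * Q" using Ms(2) by linarith
    also have "\<dots> = \<theta> * (\<eta>\<^sup>2 / 2 + 2 * X + \<theta> * Q)"
      by (simp add: \<xi>_def power2_eq_square algebra_simps)
    finally have "0 \<le> \<eta>\<^sup>2 / 2 + 2 * X + \<theta> * Q" using \<theta>(1) by (simp add: zero_le_mult_iff)
    then have "- (\<eta>\<^sup>2) \<le> 2 * X" using \<theta>Q by linarith
    \<comment> \<open>The possible loss \<open>X \<ge> - \<eta>\<^sup>2 / 2\<close> is outweighed by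
      \<open>\<Phi> Ms \<ge> \<eta>\<^sup>2\<close>.\<close>
    moreover have "(\<Sum>i\<in>V. w i * y M i) = X + \<Phi> Ms"
      unfolding wy[symmetric] X_def by (simp add: sum.distrib[symmetric] algebra_simps)
    ultimately show ?thesis using \<Phi>_ge[OF Ms(1)] zero_le_power2[of \<eta>] by linarith
  qed
  define T where "T = sum w V"
  have "T \<noteq> 0"
  proof
    assume "T = 0"
    then have "\<forall>i\<in>V. w i = 0" unfolding T_def using sum_nonneg_eq_0_iff[OF fin, of w] w0 by auto
    then have "\<Phi> Ms = 0" unfolding wy[symmetric] by simp
    then show False using \<Phi>_ge[OF Ms(1)] \<eta> by simp
  qed
  moreover have "0 \<le> T" unfolding T_def by (intro sum_nonneg w0)
  ultimately have T: "T > 0" by simp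
  define d where "d i = \<tau> * w i / T" for i
  have "psd_on V (\<lambda>u w. A u w + (if u = w then d u else 0))"
    unfolding psd_on_iff_bil
  proof (intro conjI allI)
    show "symmetric_on V (\<lambda>u w. A u w + (if u = w then d u else 0))"
      using sym by (auto simp: symmetric_on_def)
    fix x :: "'a \<Rightarrow> real"
    have bd: "bil V (\<lambda>u w. if u = w then d u else 0) x x = (\<Sum>i\<in>V. d i * (x i)\<^sup>2)"
      using fin by (simp add: bil_def if_distrib[where f="\<lambda>a. _ * a * _"] if_distrib[where f="\<lambda>a. _ * a"]
          power2_eq_square mult_ac cong: if_cong)
    define q where "q = ip V x x"
    show "0 \<le> bil V (\<lambda>u w. A u w + (if u = w then d u else 0)) x x"
    proof (cases "q = 0")
      case True
      then have "x i = 0" if "i \<in> V" for i using ip_eq_0D[OF fin _ that, of x] by (simp add: q_def)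
      then show ?thesis by (simp add: bil_def)
    next
      case False
      then have q: "q > 0" using ip_nonneg[of V x] by (simp add: q_def)
      \<comment> \<open>On the rank-one matrix of the direction \<open>x\<close>, the inequality
        \<open>main\<close> is the desired one up to the positive factor
        \<open>T / q\<close>.\<close>
      define M where "M = (\<lambda>i j. (1 / q) * (x i * x j))"
      have "psd_on V M"
        using psd_on_rank_one_sum[of "{0::nat}" "\<lambda>_. 1 / q" V "\<lambda>_. x"] q by (simp add: M_def)
      moreover have "(\<Sum>i\<in>V. M i i) = 1"
        using q unfolding M_def sum_distrib_left[symmetric] by (simp add: q_def ip_def)
      ultimately have MS: "M \<in> S" by (simp add: S_def)
      have AM: "mat_inner V A M = (1 / q) * bil V A x x"
        by (simp add: mat_inner_def M_def bil_def sum_distrib_left mult_ac)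
      have "(\<Sum>i\<in>V. w i * y M i) = (\<Sum>i\<in>V. (1 / q) * (\<tau> * w i * (x i)\<^sup>2 + w i * bil V A x x))"
        unfolding y_def AM by (intro sum.cong refl) (simp add: M_def power2_eq_square algebra_simps)
      also have "\<dots> = (1 / q) * ((\<Sum>i\<in>V. \<tau> * w i * (x i)\<^sup>2) + T * bil V A x x)"
        by (simp only: sum_distrib_left[symmetric] sum.distrib T_def sum_distrib_right[symmetric])
      also have "(\<Sum>i\<in>V. \<tau> * w i * (x i)\<^sup>2) = T * (\<Sum>i\<in>V. d i * (x i)\<^sup>2)"
        using T by (simp add: d_def sum_distrib_left)
      finally have "0 \<le> (1 / q) * (T * ((\<Sum>i\<in>V. d i * (x i)\<^sup>2) + bil V A x x))"
        using main[OF MS] by (simp add: algebra_simps)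
      then have "0 \<le> (\<Sum>i\<in>V. d i * (x i)\<^sup>2) + bil V A x x"
        using q T by (simp add: zero_le_mult_iff zero_le_divide_iff)
      then show ?thesis by (simp add: bil_add_mat bd)
    qed
  qed
  moreover have "sum d V = \<tau>"
    using T by (simp add: d_def sum_divide_distrib[symmetric] sum_distrib_left[symmetric] T_def)
  moreover have "\<forall>i\<in>V. 0 \<le> d i" using \<tau>(1) T w0 by (simp add: d_def)
  ultimately show ?thesis by blast
qed

section \<open>Graphs close to disjoint unions of cliques\<close>

lemma zero_one_adj_mat:
  assumes "simple_graph G"
  shows "zero_one_matrix (adj_mat G)"
proof
  fix u v
  show "adj_mat G u v = 0 \<or> adj_mat G u v = 1" by (simp add: adj_mat_def)
  show "adj_mat G u v = adj_mat G v u" by (simp add: adj_mat_def adjacent_def insert_commute)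
  have "{u} \<notin> edges G" using assms by (auto simp: simple_graph_def all_pairs_def)
  then show "adj_mat G u u = 0" by (simp add: adj_mat_def adjacent_def)
qed

lemma mat_inner_le_sp_star:
  assumes G: "simple_graph G" and M: "psd_on (verts G) M" "\<And>i. i \<in> verts G \<Longrightarrow> M i i \<le> 1"
  shows "- mat_inner (verts G) (adj_mat G) M \<le> 2 * sp_star G"
proof -
  let ?V = "verts G"
  let ?S = "{1 / 2 * mat_inner ?V (\<lambda>i j. - adj_mat G i j) M | M.
     psd_on ?V M \<and> (\<forall>i\<in>?V. M i i \<le> 1)}"
  have fin: "finite ?V" using G by (simp add: simple_graph_def)
  have "bdd_above ?S"
  proof (rule bdd_aboveI)
    fix z assume "z \<in> ?S"
    then obtain N where z: "z = 1 / 2 * mat_inner ?V (\<lambda>i j. - adj_mat G i j) N" and N: "psd_on ?V N"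
      "\<And>i. i \<in> ?V \<Longrightarrow> N i i \<le> 1" by blast
    have "\<bar>mat_inner ?V (\<lambda>i j. - adj_mat G i j) N\<bar> \<le> (\<Sum>i\<in>?V. \<Sum>j\<in>?V. \<bar>- adj_mat G i j\<bar>)"
      by (intro abs_mat_inner_le psd_on_entry_le_1[OF fin N])
    then show "z \<le> (\<Sum>i\<in>?V. \<Sum>j\<in>?V. \<bar>- adj_mat G i j\<bar>)" unfolding z by linarith
  qed
  moreover have "1 / 2 * mat_inner ?V (\<lambda>i j. - adj_mat G i j) M \<in> ?S" using M by blast
  ultimately have "1 / 2 * mat_inner ?V (\<lambda>i j. - adj_mat G i j) M \<le> sp_star G"
    unfolding sp_star_def by (intro cSup_upper)
  then show ?thesis by (simp add: mat_inner_def sum_negf)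
qed

text \<open>Vertices of \<open>V\<close> outside \<open>U\<close> are isolated and thus form cliques
  of size 1.\<close>

definition cluster_graph :: "'a set \<Rightarrow> 'a set \<Rightarrow> ('a \<Rightarrow> 'a) \<Rightarrow> 'a sgraph" where
  "cluster_graph V U f = \<lparr>verts = V, edges = {{u, w} | u w. u \<in> U \<and> w \<in> U \<and> u \<noteq> w \<and> f u = f w}\<rparr>"

lemma adjacent_cluster_graph:
  "adjacent (cluster_graph V U f) u w \<longleftrightarrow> u \<in> U \<and> w \<in> U \<and> u \<noteq> w \<and> f u = f w"
  by (auto simp: adjacent_def cluster_graph_def doubleton_eq_iff)

text \<open>Having equal labels is transitive, so reachable vertices are equal or adjacent.\<close>

lemma disjoint_union_of_cliques_cluster_graph:
  assumes "finite V" "U \<subseteq> V"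
  shows "disjoint_union_of_cliques (cluster_graph V U f)"
proof -
  let ?H = "cluster_graph V U f"
  have "simple_graph ?H"
    using assms by (auto simp: simple_graph_def all_pairs_def cluster_graph_def)
  moreover have "clique_in ?H K" if K_in: "K \<in> components_of_graph ?H" for K
  proof -
    obtain v where K: "K = {w \<in> verts ?H. reachable ?H v w}" using K_in by (auto simp: components_of_graph_def)
    have reach: "v = w \<or> adjacent ?H v w" if "reachable ?H v w" for w
      using that unfolding reachable_def
      by (induction rule: rtranclp_induct) (auto simp: adjacent_cluster_graph)
    show ?thesis unfolding clique_in_def
    proof (intro ballI impI)
      fix u w assume "u \<in> K" "w \<in> K" "u \<noteq> w"
      then show "adjacent ?H u w"
        using reach[of u] reach[of w] by (auto simp: K adjacent_cluster_graph)
    qed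
  qed
  ultimately show ?thesis by (simp add: disjoint_union_of_cliques_def)
qed

text \<open>Every edited pair either lies in \<open>U\<close> and is counted by the cost, or meets
  \<open>verts G - U\<close>; there are at most card \<open>(verts G - U)\<close> times card
  \<open>(verts G)\<close> pairs of the second kind. The isomorphism is the identity.\<close>

lemma eps_close_cluster_graph:
  assumes G: "simple_graph G" and U: "U \<subseteq> verts G"
    and le: "zero_one_matrix.cost (adj_mat G) f U + real (card (verts G - U)) * real (card (verts G))
      \<le> \<epsilon> * (real (card (verts G)))\<^sup>2"
  shows "eps_close \<epsilon> G (cluster_graph (verts G) U f)"
proof -
  interpret zero_one_matrix "adj_mat G" by (rule zero_one_adj_mat[OF G])
  let ?V = "verts G" and ?H = "cluster_graph (verts G) U f"
  have fin: "finite ?V" "finite U" using G U finite_subset by (auto simp: simple_graph_def)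
  define R where "R = edges G - edges ?H"
  define Ad where "Ad = edges ?H - edges G"
  have simpleH: "edges ?H \<subseteq> all_pairs ?V" using U by (auto simp: cluster_graph_def all_pairs_def)
  have simpleG: "edges G \<subseteq> all_pairs ?V" using G by (simp add: simple_graph_def)
  define Z where "Z = {p \<in> U \<times> U. err f (fst p) (snd p) = 1}"
  have "cost f U = (\<Sum>p\<in>U \<times> U. err f (fst p) (snd p))"
    by (simp add: cost_def sum.cartesian_product case_prod_beta)
  also have "\<dots> = real (card Z)" unfolding Z_def
    using fin A01 by (intro sum_eq_card_support) (auto simp: err_def)
  finally have cost: "cost f U = real (card Z)" .
  have cover: "R \<union> Ad \<subseteq> (\<lambda>p. {fst p, snd p}) ` Z \<union> (\<lambda>p. {fst p, snd p}) ` ((?V - U) \<times> ?V)"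
  proof
    fix e assume e: "e \<in> R \<union> Ad"
    then have "e \<in> all_pairs ?V" using simpleG simpleH by (auto simp: R_def Ad_def)
    then obtain u w where uw: "e = {u, w}" "u \<noteq> w" "u \<in> ?V" "w \<in> ?V"
      by (auto simp: all_pairs_def card_2_iff)
    show "e \<in> (\<lambda>p. {fst p, snd p}) ` Z \<union> (\<lambda>p. {fst p, snd p}) ` ((?V - U) \<times> ?V)"
    proof (cases "u \<in> U \<and> w \<in> U")
      case True
      have "adjacent G u w \<longleftrightarrow> \<not> adjacent ?H u w" using e uw(1) by (auto simp: R_def Ad_def adjacent_def)
      then have "err f u w = 1" using True uw(2) by (auto simp: err_def adj_mat_def adjacent_cluster_graph)
      then have "(u, w) \<in> Z" using True by (simp add: Z_def)
      then show ?thesis using uw(1) by force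
    next
      case False
      then show ?thesis
      proof (cases "u \<in> U")
        case True
        then have "(w, u) \<in> (?V - U) \<times> ?V" using False uw by auto
        moreover have "e = {fst (w, u), snd (w, u)}" using uw(1) by auto
        ultimately show ?thesis by blast
      next
        case False
        then have "(u, w) \<in> (?V - U) \<times> ?V" using uw by auto
        moreover have "e = {fst (u, w), snd (u, w)}" using uw(1) by auto
        ultimately show ?thesis by blast
      qed
    qed
  qed
  have finZ: "finite Z" using fin by (simp add: Z_def)
  have finRA: "finite R" "finite Ad"
    using cover finZ fin by (auto intro: finite_subset[of _ "(\<lambda>p. {fst p, snd p}) ` Z \<union> (\<lambda>p. {fst p, snd p}) ` ((?V - U) \<times> ?V)"])
  have "card R + card Ad = card (R \<union> Ad)"
    using finRA by (intro card_Un_disjoint[symmetric]) (auto simp: R_def Ad_def)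
  also have "\<dots> \<le> card ((\<lambda>p. {fst p, snd p}) ` Z \<union> (\<lambda>p. {fst p, snd p}) ` ((?V - U) \<times> ?V))"
    using finZ fin by (intro card_mono cover) auto
  also have "\<dots> \<le> card ((\<lambda>p. {fst p, snd p}) ` Z) + card ((\<lambda>p. {fst p, snd p}) ` ((?V - U) \<times> ?V))"
    by (rule card_Un_le)
  also have "\<dots> \<le> card Z + card ((?V - U) \<times> ?V)"
    using finZ fin by (intro add_mono card_image_le) auto
  finally have "card R + card Ad \<le> card Z + card (?V - U) * card ?V" by (simp add: card_cartesian_product)
  then have "real (card R + card Ad) \<le> real (card Z + card (?V - U) * card ?V)" by (simp only: of_nat_le_iff)
  then have "real (card R + card Ad) \<le> cost f U + real (card (?V - U)) * real (card ?V)" by (simp add: cost)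
  then have "real (card R + card Ad) \<le> \<epsilon> * (real (card ?V))\<^sup>2" using le by linarith
  moreover have "(edges G - R) \<union> Ad = edges ?H" by (auto simp: R_def Ad_def)
  then have "graph_iso (G\<lparr>edges := (edges G - R) \<union> Ad\<rparr>) ?H"
    unfolding graph_iso_def by (intro exI[of _ "\<lambda>u. u"]) (simp add: cluster_graph_def adjacent_def bij_betw_def)
  moreover have "R \<subseteq> edges G" "Ad \<subseteq> all_pairs ?V - edges G" using simpleH by (auto simp: R_def Ad_def)
  ultimately show ?thesis unfolding eps_close_def by blast
qed

text \<open>The contrapositive of the main claim: dual weights give a semidefinite shift of the
  adjacency matrix on most vertices, and clustering these vertices produces
  \<open>H\<close>.\<close>

lemma close_of_small_sp_star:
  fixes \<epsilon> :: real
  assumes \<epsilon>: "0 < \<epsilon>"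
  shows "\<exists>n\<^sub>0 :: nat. \<forall>G :: 'a sgraph. simple_graph G \<longrightarrow> n\<^sub>0 \<le> card (verts G) \<longrightarrow>
    sp_star G < 1 / 2 * real (card (verts G)) powr (1 + 1 / 99) \<longrightarrow>
    (\<exists>H :: 'a sgraph. disjoint_union_of_cliques H \<and> verts H = verts G \<and> eps_close \<epsilon> G H)"
proof -
  \<comment> \<open>The edit budget is spent in shares of \<open>\<delta> * n\<^sup>2\<close>:
    splitting off clusters, edges that remain at the end, and pairs meeting discarded
    vertices.\<close>
  define \<delta> where "\<delta> = min 1 \<epsilon> / 4"
  have \<delta>: "0 < \<delta>" "\<delta> \<le> 1" "4 * \<delta> \<le> \<epsilon>" using \<epsilon> by (auto simp: \<delta>_def)
  obtain \<kappa> where \<kappa>: "\<kappa> > 0" and cliques: "\<And>(A :: 'a \<Rightarrow> 'a \<Rightarrow> real) W l. zero_one_matrix A \<Longrightarrow> finite W \<Longrightarrow>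
      psd_on W (shifted A l) \<Longrightarrow> 1 \<le> l \<Longrightarrow> l ^ 10 \<le> \<kappa> * real (card W) \<Longrightarrow>
      \<delta> * (real (card W))\<^sup>2 \<le> (\<Sum>u\<in>W. \<Sum>w\<in>W. A u w) \<Longrightarrow>
      \<exists>C\<subseteq>W. zero_one_matrix.is_clique A C \<and> 40 * l ^ 3 \<le> real (card C)"
    using large_clique[OF \<delta>(1), where 'a='a] by blast
  \<comment> \<open>From \<open>z \<le> sqrt n\<close> on, the bound
    \<open>sqrt n / \<delta> ^ 10\<close> on \<open>l ^ 10\<close> is at most
    \<open>\<kappa> * \<delta> * n\<close>.\<close>
  define z where "z = 1 / (\<kappa> * \<delta> * \<delta> ^ 10)"
  have z: "z > 0" using \<kappa> \<delta> by (simp add: z_def)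
  define n\<^sub>0 where "n\<^sub>0 = Suc (nat \<lceil>z\<^sup>2\<rceil>)"
  have "\<exists>H :: 'a sgraph. disjoint_union_of_cliques H \<and> verts H = verts G \<and> eps_close \<epsilon> G H"
    if G: "simple_graph G" and n0: "n\<^sub>0 \<le> card (verts G)"
      and sp: "sp_star G < 1 / 2 * real (card (verts G)) powr (1 + 1 / 99)" for G :: "'a sgraph"
  proof -
    define V where "V = verts G"
    define A where "A = adj_mat G"
    define n where "n = real (card V)"
    interpret zero_one_matrix A unfolding A_def by (rule zero_one_adj_mat[OF G])
    have fin: "finite V" using G by (simp add: V_def simple_graph_def)
    have n1: "n \<ge> 1" using n0 by (simp add: n_def V_def n\<^sub>0_def)
    have "z\<^sup>2 \<le> real (nat \<lceil>z\<^sup>2\<rceil>)" by (rule real_nat_ceiling_ge)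
    also have "\<dots> \<le> n" using n0 by (simp add: n_def V_def n\<^sub>0_def)
    finally have zn: "z \<le> sqrt n" using z by (simp add: real_le_rsqrt)
    have ne: "V \<noteq> {}" using n1 by (auto simp: n_def)
    define \<tau> where "\<tau> = n powr (1 + 1 / 99)"
    have sym: "symmetric_on V A" using A_sym by (simp add: symmetric_on_def)
    obtain d where d0: "\<And>i. i \<in> V \<Longrightarrow> 0 \<le> d i" and d_sum: "sum d V = \<tau>"
      and psd: "psd_on V (\<lambda>u w. A u w + (if u = w then d u else 0))"
    proof -
      have "2 * sp_star G < \<tau>" using sp by (simp add: \<tau>_def n_def V_def)
      from sdp_duality[OF fin ne sym _ this] mat_inner_le_sp_star[OF G]
      show ?thesis using that by (auto simp: A_def V_def \<tau>_def)
    qed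
    define l where "l = n powr (1 / 99) / \<delta>"
    have npow: "n powr (1 / 99) \<ge> 1" using n1 by (simp add: ge_one_powr_ge_zero)
    have l_ge: "1 / \<delta> \<le> l" using npow \<delta> by (simp add: l_def divide_right_mono)
    moreover have "1 \<le> 1 / \<delta>" using \<delta> by simp
    ultimately have l1: "1 \<le> l" by linarith
    have l_inv: "1 / l \<le> \<delta>" using l_ge l1 \<delta> by (simp add: field_simps)
    \<comment> \<open>Markov's inequality for the dual weights: their total is
      \<open>\<delta> * n * l\<close>, so at most \<open>\<delta> * n\<close> of them exceed
      \<open>l\<close>. On \<open>U\<close> the diagonal can be raised to the constant
      \<open>l\<close>.\<close>
    define U where "U = {u \<in> V. d u \<le> l}"
    have UV: "U \<subseteq> V" "finite U" using fin by (auto simp: U_def)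
    have "real (card (V - U)) * l = (\<Sum>u\<in>V - U. l)" by simp
    also have "\<dots> \<le> (\<Sum>u\<in>V - U. d u)" by (intro sum_mono) (auto simp: U_def)
    also have "\<dots> \<le> sum d V" using fin d0 by (intro sum_mono2) auto
    also have "\<dots> = n * n powr (1 / 99)" unfolding d_sum \<tau>_def powr_add using n1 by simp
    also have "\<dots> = \<delta> * n * l" using \<delta> by (simp add: l_def)
    finally have VU: "real (card (V - U)) \<le> \<delta> * n" using l1 by simp
    have "psd_on U (\<lambda>u w. A u w + (if u = w then d u else 0))" by (rule psd_on_subset[OF psd UV(1) fin])
    moreover have "psd_on U (\<lambda>u w. if u = w then l - d u else 0)"
    proof -
      have "bil U (\<lambda>u w. if u = w then l - d u else 0) x x = (\<Sum>i\<in>U. (l - d i) * (x i)\<^sup>2)" for x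
        using UV(2) by (simp add: bil_def if_distrib[where f="\<lambda>a. _ * a * _"] if_distrib[where f="\<lambda>a. _ * a"]
            power2_eq_square mult_ac cong: if_cong)
      then show ?thesis
        by (auto simp: psd_on_iff_bil symmetric_on_def U_def intro!: sum_nonneg)
    qed
    ultimately have psdU: "psd_on U (shifted A l)"
      by (rule psd_on_cong[OF _ psd_on_add, rotated]) (simp add: shifted_def)
    have l10: "l ^ 10 \<le> \<kappa> * (\<delta> * n)"
    proof -
      \<comment> \<open>The exponent 1/99 enters here: the tenth power of \<open>l\<close> must stay
        of order at most \<open>sqrt n\<close>.\<close>
      have "(n powr (1 / 99)) ^ 10 = n powr (10 / 99)" using n1 by (simp add: powr_power)
      also have "\<dots> \<le> n powr (1 / 2)" using n1 by (intro powr_mono) auto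
      also have "\<dots> = sqrt n" using n1 by (simp add: powr_half_sqrt)
      finally have "l ^ 10 \<le> sqrt n * (1 / \<delta> ^ 10)" using \<delta> by (simp add: l_def power_divide divide_right_mono)
      also have "1 / \<delta> ^ 10 = \<kappa> * \<delta> * z" using \<kappa> \<delta> by (simp add: z_def)
      also have "sqrt n * (\<kappa> * \<delta> * z) \<le> sqrt n * (\<kappa> * \<delta> * sqrt n)"
        using zn \<kappa> \<delta> n1 by (intro mult_left_mono) auto
      also have "\<dots> = \<kappa> * \<delta> * (sqrt n * sqrt n)" by (simp only: mult_ac)
      also have "\<dots> = \<kappa> * (\<delta> * n)" using n1 by simp
      finally show ?thesis .
    qed
    have Un: "real (card U) \<le> n" using card_mono[OF fin UV(1)] by (simp add: n_def)
    have "\<exists>C\<subseteq>W. is_clique C \<and> 40 * l ^ 3 \<le> real (card C)"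
      if W: "W \<subseteq> U" and e: "\<delta> * n\<^sup>2 \<le> (\<Sum>u\<in>W. \<Sum>w\<in>W. A u w)" for W
    proof -
      have finW: "finite W" using W UV finite_subset by blast
      have Wn: "real (card W) \<le> n" using card_mono[OF UV(2) W] Un by linarith
      \<comment> \<open>A set with \<open>\<delta> * n\<^sup>2\<close> ordered edges has at least
        \<open>\<delta> * n\<close> vertices, so it is large enough for the clique theorem.\<close>
      have "(\<delta> * n)\<^sup>2 \<le> \<delta> * n\<^sup>2"
        using \<delta> mult_right_mono[of "\<delta> * \<delta>" \<delta> "n\<^sup>2"] by (simp add: power_mult_distrib power2_eq_square[of \<delta>])
      also have "\<dots> \<le> (\<Sum>u\<in>W. nbr u W)" using e by (simp add: nbr_def)
      also have "\<dots> \<le> (\<Sum>u\<in>W. real (card W))" by (intro sum_mono nbr_le_card finW)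
      also have "\<dots> = (real (card W))\<^sup>2" by (simp add: power2_eq_square)
      finally have "\<delta> * n \<le> real (card W)" by (rule power2_le_imp_le) simp
      then have "\<kappa> * (\<delta> * n) \<le> \<kappa> * real (card W)" using \<kappa> by simp
      then have 1: "l ^ 10 \<le> \<kappa> * real (card W)" using l10 by linarith
      have "\<delta> * (real (card W))\<^sup>2 \<le> \<delta> * n\<^sup>2" using Wn \<delta> by (intro mult_left_mono power_mono) auto
      then have 2: "\<delta> * (real (card W))\<^sup>2 \<le> (\<Sum>u\<in>W. \<Sum>w\<in>W. A u w)" using e by linarith
      show ?thesis
        by (rule cliques[OF zero_one_matrix_axioms finW psd_on_subset[OF psdU W UV(2)] l1 1 2])
    qed
    from cluster_labelling[OF UV(2) psdU l1 Un this order_refl] obtain f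
      where f: "cost f U \<le> real (card U) * n / l + \<delta> * n\<^sup>2" by blast
    have "real (card U) * n * (1 / l) \<le> n * n * \<delta>"
      using Un l_inv n1 l1 by (intro mult_mono) auto
    then have "real (card U) * n / l \<le> \<delta> * n\<^sup>2" by (simp add: power2_eq_square mult_ac)
    with f have "cost f U \<le> 2 * (\<delta> * n\<^sup>2)" by linarith
    moreover have "real (card (V - U)) * n \<le> \<delta> * n\<^sup>2"
      using mult_right_mono[OF VU, of n] n1 by (simp add: power2_eq_square mult_ac)
    moreover have "4 * (\<delta> * n\<^sup>2) \<le> \<epsilon> * n\<^sup>2"
      using mult_right_mono[OF \<delta>(3), of "n\<^sup>2"] by simp
    moreover have "0 \<le> \<delta> * n\<^sup>2" using \<delta> by simp
    ultimately have "cost f U + real (card (V - U)) * n \<le> \<epsilon> * n\<^sup>2" by linarith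
    then have "eps_close \<epsilon> G (cluster_graph V U f)"
      using eps_close_cluster_graph[OF G, of U f \<epsilon>] UV(1) by (simp add: V_def n_def A_def)
    moreover have "disjoint_union_of_cliques (cluster_graph V U f)"
      by (rule disjoint_union_of_cliques_cluster_graph[OF fin UV(1)])
    moreover have "verts (cluster_graph V U f) = verts G" by (simp add: cluster_graph_def V_def)
    ultimately show ?thesis by blast
  qed
  then show ?thesis by blast
qed

theorem theorem7p1:
  fixes c :: real
  assumes "c = 1 / 99"
  shows "\<forall>\<epsilon>>0. \<exists>n\<^sub>0 :: nat. \<forall>n\<ge>n\<^sub>0. \<forall>G :: 'a sgraph.
    simple_graph G \<longrightarrow> card (verts G) = n \<longrightarrow>
    (\<forall>H :: 'a sgraph. disjoint_union_of_cliques H \<longrightarrow> card (verts H) = n \<longrightarrow> eps_far \<epsilon> G H) \<longrightarrow>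
    sp_star G \<ge> 1 / 2 * real n powr (1 + c)"
proof (intro allI impI)
  fix \<epsilon> :: real assume "0 < \<epsilon>"
  from close_of_small_sp_star[OF this, where 'a='a] obtain n\<^sub>0 :: nat
    where n\<^sub>0: "\<And>G :: 'a sgraph. simple_graph G \<Longrightarrow> n\<^sub>0 \<le> card (verts G) \<Longrightarrow>
      sp_star G < 1 / 2 * real (card (verts G)) powr (1 + 1 / 99) \<Longrightarrow>
      \<exists>H :: 'a sgraph. disjoint_union_of_cliques H \<and> verts H = verts G \<and> eps_close \<epsilon> G H" by blast
  have "1 / 2 * real n powr (1 + c) \<le> sp_star G"
    if G: "n\<^sub>0 \<le> n" "simple_graph G" "card (verts G) = n"
      "\<forall>H :: 'a sgraph. disjoint_union_of_cliques H \<longrightarrow> card (verts H) = n \<longrightarrow> eps_far \<epsilon> G H"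
    for n and G :: "'a sgraph"
  proof (rule ccontr)
    assume "\<not> ?thesis"
    then obtain H :: "'a sgraph" where "disjoint_union_of_cliques H" "verts H = verts G" "eps_close \<epsilon> G H"
      using n\<^sub>0[of G] G assms by auto
    then show False using G by (auto simp: eps_far_def)
  qed
  then show "\<exists>n\<^sub>0 :: nat. \<forall>n\<ge>n\<^sub>0. \<forall>G :: 'a sgraph.
    simple_graph G \<longrightarrow> card (verts G) = n \<longrightarrow>
    (\<forall>H :: 'a sgraph. disjoint_union_of_cliques H \<longrightarrow> card (verts H) = n \<longrightarrow> eps_far \<epsilon> G H) \<longrightarrow>
    sp_star G \<ge> 1 / 2 * real n powr (1 + c)" by blast
qed

end
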